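(* Let $d \geq 1$ and $k \geq 3$, and let $\mathcal{C} = \{C_1, \dots, C_k\} \subset \mathbb{P}^2_{\mathbb{C}}$ be a $d$-arrangement of $k$ curves. In the case $d = 1$ assume additionally that $t_{k-1} = 0$. Then $$\varepsilon_{\mathcal{C}}(\mathcal{O}_{\mathbb{P}^2_{\mathbb{C}}}(1)) \geq \frac{1}{2dk + \frac{3d}{2} - \frac{9}{2}}.$$
   Context: Work over the complex numbers. An arrangement $\mathcal{C} = \{C_1,\dots,C_k\}$ of $k \geq 3$ (distinct) curves in $\mathbb{P}^2_{\mathbb{C}}$ is a $d$-arrangement, $d \geq 1$, if: (i) every $C_i$ is smooth of degree $d$; (ii) all singular points of $\mathcal{C}$ are ordinary, i.e. they look locally as $\{x^{\ell} = y^{\ell}\}$ for some $\ell \geq 2$ (so $\ell$ smooth branches with pairwise distinct tangents meet there); (iii) there is no point where all the curves meet. $\mathrm{Sing}(\mathcal{C})$ denotes the set of all singular points of the components together with all points where two or more of the curves intersect. For $P \in \mathrm{Sing}(\mathcal{C})$, $\mathrm{mult}_P(\mathcal{C})$ is the multiplicity at $P$ of the divisor $C_1 + \dots + C_k$, and $\deg(\mathcal{C})$ is the degree of this divisor (so $\deg(\mathcal{C}) = dk$ here). For $r \geq 2$, $t_r$ is the number of points of $\mathrm{Sing}(\mathcal{C})$ of multiplicity exactly $r$. The configurational Seshadri constant of $\mathcal{C}$ is $$\varepsilon_{\mathcal{C}}(\mathcal{O}_{\mathbb{P}^2_{\mathbb{C}}}(1)) = \frac{\deg(\mathcal{C})}{\sum_{P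 \in \mathrm{Sing}(\mathcal{C})} \mathrm{mult}_P(\mathcal{C})}.$$ *)

theory Defs
  imports "HOL-Analysis.Analysis" "HOL-Library.Poly_Mapping" "HOL-Computational_Algebra.Polynomial"
begin

subsection \<open>The complex projective plane\<close>

definition proj_rel :: "complex^3 \<Rightarrow> complex^3 \<Rightarrow> bool" where
  "proj_rel u v \<longleftrightarrow> u \<noteq> 0 \<and> (\<exists>c. c \<noteq> 0 \<and> v = c *s u)"

lemma proj_rel_part_equivp: "part_equivp proj_rel"
proof (rule part_equivpI)
  show "\<exists>x. proj_rel x x"
    by (rule exI[of _ "axis 1 1"])
       (auto simp: proj_rel_def axis_eq_0_iff intro!: exI[of _ 1])
  show "symp proj_rel"
  proof (rule sympI)
    fix u v assume "proj_rel u v"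
    then obtain c where c: "u \<noteq> 0" "c \<noteq> 0" "v = c *s u"
      by (auto simp: proj_rel_def)
    then have "u = inverse c *s v" "v \<noteq> 0"
      by (auto simp: vec_eq_iff)
    with c(2) show "proj_rel v u"
      unfolding proj_rel_def by (metis nonzero_imp_inverse_nonzero)
  qed
  show "transp proj_rel"
  proof (rule transpI)
    fix u v w assume "proj_rel u v" "proj_rel v w"
    then obtain a b where "u \<noteq> 0" "a \<noteq> 0" "b \<noteq> 0" "w = (b * a) *s u"
      by (auto simp: proj_rel_def vector_smult_assoc)
    then show "proj_rel u w"
      unfolding proj_rel_def by (metis mult_eq_0_iff)
  qed
qed

quotient_type proj_plane = "complex^3" / partial: proj_rel
  by (rule proj_rel_part_equivp)

text \<open>
  \<open>rep_proj_plane P\<close> is a vector of homogeneous coordinates of \<open>P\<close>. The notions below that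
  refer to it do not depend on the choice of coordinates for homogeneous polynomials;
  see \<open>vanishes_indep\<close>, \<open>singular_indep\<close>, \<open>mult_indep\<close>, \<open>tangent_cone_indep\<close>.
\<close>

lemma rep_proj_plane_rel: "proj_rel (rep_proj_plane P) (rep_proj_plane P)"
  by (rule Quotient3_rep_reflp[OF Quotient3_proj_plane])


subsection \<open>Polynomials in three variables\<close>

type_synonym poly3 = "(3 \<Rightarrow>\<^sub>0 nat) \<Rightarrow>\<^sub>0 complex"

definition monom_deg :: "(3 \<Rightarrow>\<^sub>0 nat) \<Rightarrow> nat" where
  "monom_deg m = (\<Sum>i\<in>UNIV. Poly_Mapping.lookup m i)"

definition total_deg :: "poly3 \<Rightarrow> nat" where
  "total_deg F = Max (insert 0 (monom_deg ` Poly_Mapping.keys F))"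

definition homogeneous :: "nat \<Rightarrow> poly3 \<Rightarrow> bool" where
  "homogeneous d F \<longleftrightarrow> (\<forall>m\<in>Poly_Mapping.keys F. monom_deg m = d)"

definition eval3 :: "poly3 \<Rightarrow> complex^3 \<Rightarrow> complex" where
  "eval3 F x =
     (\<Sum>m\<in>Poly_Mapping.keys F. Poly_Mapping.lookup F m * (\<Prod>i\<in>UNIV. (x $ i) ^ Poly_Mapping.lookup m i))"

definition pdiff :: "3 \<Rightarrow> poly3 \<Rightarrow> poly3" where
  "pdiff i F =
     (\<Sum>m\<in>Poly_Mapping.keys F.
        Poly_Mapping.single (m - Poly_Mapping.single i 1)
          (of_nat (Poly_Mapping.lookup m i) * Poly_Mapping.lookup F m))"

text \<open>The polynomial \<open>F(p + t v)\<close> in the variable \<open>t\<close>.\<close>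

definition along_line :: "poly3 \<Rightarrow> complex^3 \<Rightarrow> complex^3 \<Rightarrow> complex poly" where
  "along_line F p v =
     (\<Sum>m\<in>Poly_Mapping.keys F.
        smult (Poly_Mapping.lookup F m) (\<Prod>i\<in>UNIV. [:p $ i, v $ i:] ^ Poly_Mapping.lookup m i))"

lemma poly_along_line: "poly (along_line F p v) t = eval3 F (p + t *s v)"
  by (simp add: along_line_def eval3_def poly_sum poly_prod)


subsection \<open>Multiplicities and ordinary points\<close>

text \<open>
  Write \<open>F(p + t v) = (\<Sum>j. F\<^sub>j(v) t\<^sup>j)\<close>, so that \<open>F\<^sub>j\<close> is the homogeneous part of
  degree \<open>j\<close> of the expansion of \<open>F\<close> at \<open>p\<close>. The multiplicity is the least \<open>j\<close> with
  \<open>F\<^sub>j \<noteq> 0\<close> and the tangent cone is the corresponding \<open>F\<^sub>j\<close>. A local affine equation of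
  the plane curve at \<open>p\<close> is obtained by restricting \<open>v\<close> to a plane complementary to the line
  \<open>\<complex> p\<close>. Letting \<open>v\<close> range over all of \<open>\<complex>\<^sup>3\<close> changes neither notion: if \<open>F\<close> is
  homogeneous of degree \<open>d\<close>, then
  \<open>F(p + t (v + s p)) = (1 + t s)\<^sup>d F(p + t / (1 + t s) v)\<close>, so the lowest nonzero part is
  invariant under \<open>v \<mapsto> v + s p\<close>, that is, it is a form on \<open>\<complex>\<^sup>3 / \<complex> p\<close>.
\<close>

definition mult_vec :: "poly3 \<Rightarrow> complex^3 \<Rightarrow> nat" where
  "mult_vec F p = (LEAST j. \<exists>v. coeff (along_line F p v) j \<noteq> 0)"

definition mult_at :: "poly3 \<Rightarrow> proj_plane \<Rightarrow> nat" where
  "mult_at F P = mult_vec F (rep_proj_plane P)"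

definition tangent_cone :: "poly3 \<Rightarrow> proj_plane \<Rightarrow> complex^3 \<Rightarrow> complex" where
  "tangent_cone F P v = coeff (along_line F (rep_proj_plane P) v) (mult_at F P)"

text \<open>
  A point of multiplicity \<open>l \<ge> 2\<close> is ordinary if there are \<open>l\<close> distinct tangents, that is, if
  the tangent cone is a product of \<open>l\<close> pairwise non-proportional linear forms.
  Then \<open>l\<close> smooth branches with distinct tangents meet there. For \<open>l \<ge> 4\<close> this is
  more general than being analytically isomorphic to \<open>x\<^sup>l = y\<^sup>l\<close>, because the
  cross-ratios of the tangents are not prescribed.
\<close>

definition ordinary_singularity :: "poly3 \<Rightarrow> proj_plane \<Rightarrow> bool" where
  "ordinary_singularity F P \<longleftrightarrow>
     (\<exists>l\<ge>2. mult_at F P = l \<and>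
        (\<exists>L :: nat \<Rightarrow> complex^3.
           (\<forall>i<l. \<forall>j<l. i \<noteq> j \<longrightarrow> (\<forall>c. L i \<noteq> c *s L j)) \<and>
           (\<forall>v. tangent_cone F P v = (\<Prod>i<l. \<Sum>a\<in>UNIV. L i $ a * v $ a))))"


subsection \<open>Plane curves\<close>

text \<open>
  A plane curve, or more generally an effective divisor, is given by a nonzero form, which is
  determined up to a nonzero constant.
\<close>

definition plane_curve :: "nat \<Rightarrow> poly3 \<Rightarrow> bool" where
  "plane_curve d F \<longleftrightarrow> F \<noteq> 0 \<and> homogeneous d F"

definition same_curve :: "poly3 \<Rightarrow> poly3 \<Rightarrow> bool" where
  "same_curve F G \<longleftrightarrow> (\<exists>c. c \<noteq> 0 \<and> G = Poly_Mapping.single 0 c * F)"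

definition curve_points :: "poly3 \<Rightarrow> proj_plane set" where
  "curve_points F = {P. eval3 F (rep_proj_plane P) = 0}"

definition singular_points :: "poly3 \<Rightarrow> proj_plane set" where
  "singular_points F =
     {P \<in> curve_points F. \<forall>i. eval3 (pdiff i F) (rep_proj_plane P) = 0}"

definition smooth_curve :: "nat \<Rightarrow> poly3 \<Rightarrow> bool" where
  "smooth_curve d F \<longleftrightarrow> plane_curve d F \<and> singular_points F = {}"


subsection \<open>Independence of the choice of homogeneous coordinates\<close>

lemma homogeneous_prod_scale:
  assumes "homogeneous d F" "m \<in> Poly_Mapping.keys F"
  shows "(\<Prod>i\<in>(UNIV::3 set). (c::'a::comm_semiring_1) ^ Poly_Mapping.lookup m i) = c ^ d"
  using assms by (simp add: homogeneous_def monom_deg_def flip: power_sum)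

lemma eval3_scale:
  assumes "homogeneous d F"
  shows "eval3 F (c *s x) = c ^ d * eval3 F x"
  unfolding eval3_def sum_distrib_left
proof (rule sum.cong[OF refl])
  fix m assume m: "m \<in> Poly_Mapping.keys F"
  show "Poly_Mapping.lookup F m * (\<Prod>i\<in>UNIV. (c *s x) $ i ^ Poly_Mapping.lookup m i)
      = c ^ d * (Poly_Mapping.lookup F m * (\<Prod>i\<in>UNIV. x $ i ^ Poly_Mapping.lookup m i))"
    unfolding vector_smult_component power_mult_distrib prod.distrib
      homogeneous_prod_scale[OF assms m]
    by (rule mult.left_commute)
qed

lemma vanishes_indep:
  assumes "homogeneous d F" "proj_rel u v"
  shows "eval3 F u = 0 \<longleftrightarrow> eval3 F v = 0"
  using assms by (auto simp: proj_rel_def eval3_scale)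

lemma homogeneous_pdiff:
  assumes "homogeneous d F"
  shows "homogeneous (d - 1) (pdiff i F)"
  unfolding homogeneous_def
proof
  fix n assume "n \<in> Poly_Mapping.keys (pdiff i F)"
  then have "n \<in> (\<Union>m\<in>Poly_Mapping.keys F.
      Poly_Mapping.keys (Poly_Mapping.single (m - Poly_Mapping.single i 1)
        (of_nat (Poly_Mapping.lookup m i) * Poly_Mapping.lookup F m)))"
    unfolding pdiff_def by (rule subsetD[OF Poly_Mapping.keys_sum])
  then obtain m where m: "m \<in> Poly_Mapping.keys F" "n = m - Poly_Mapping.single i 1"
      "Poly_Mapping.lookup m i \<noteq> 0"
    by (auto split: if_splits)
  have "monom_deg m = Poly_Mapping.lookup m i + (\<Sum>j\<in>UNIV - {i}. Poly_Mapping.lookup m j)"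
    unfolding monom_deg_def by (rule sum.remove) auto
  moreover have "monom_deg n =
      Poly_Mapping.lookup m i - 1 + (\<Sum>j\<in>UNIV - {i}. Poly_Mapping.lookup m j)"
  proof -
    have "monom_deg n = Poly_Mapping.lookup n i + (\<Sum>j\<in>UNIV - {i}. Poly_Mapping.lookup n j)"
      unfolding monom_deg_def by (rule sum.remove) auto
    also have "(\<Sum>j\<in>UNIV - {i}. Poly_Mapping.lookup n j)
        = (\<Sum>j\<in>UNIV - {i}. Poly_Mapping.lookup m j)"
      by (rule sum.cong) (auto simp: m(2) lookup_minus lookup_single)
    finally show ?thesis
      by (simp add: m(2) lookup_minus lookup_single)
  qed
  moreover have "monom_deg m = d"
    using assms m(1) by (simp add: homogeneous_def)
  ultimately show "monom_deg n = d - 1"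
    using m(3) by linarith
qed

lemma singular_indep:
  assumes "homogeneous d F" "proj_rel u v"
  shows "eval3 (pdiff i F) u = 0 \<longleftrightarrow> eval3 (pdiff i F) v = 0"
  using vanishes_indep[OF homogeneous_pdiff[OF assms(1)] assms(2)] .

lemma coeff_along_line_scale:
  assumes "homogeneous d F" "c \<noteq> 0"
  shows "c ^ j * coeff (along_line F (c *s p) v) j = c ^ d * coeff (along_line F p v) j"
proof -
  have "pcompose (along_line F (c *s p) v) [:0, c:] = smult (c ^ d) (along_line F p v)"
  proof (rule poly_eq_poly_eq_iff[THEN iffD1])
    have "poly (along_line F (c *s p) v) (t * c) = c ^ d * poly (along_line F p v) t" for t
    proof -
      have "c *s p + (t * c) *s v = c *s (p + t *s v)"
        by (simp add: vec_eq_iff algebra_simps)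
      then show ?thesis
        by (simp only: poly_along_line eval3_scale[OF assms(1)])
    qed
    then show "poly (pcompose (along_line F (c *s p) v) [:0, c:])
        = poly (smult (c ^ d) (along_line F p v))"
      by (simp add: fun_eq_iff poly_pcompose)
  qed
  then have "coeff (pcompose (along_line F (c *s p) v) [:0, c:]) j
      = coeff (smult (c ^ d) (along_line F p v)) j"
    by simp
  then show ?thesis
    by (simp add: coeff_pcompose_linear)
qed

lemma mult_indep:
  assumes "homogeneous d F" "proj_rel u w"
  shows "mult_vec F u = mult_vec F w"
proof -
  obtain c where c: "c \<noteq> 0" "w = c *s u"
    using assms(2) by (auto simp: proj_rel_def)
  have "coeff (along_line F w v) j = 0 \<longleftrightarrow> coeff (along_line F u v) j = 0" for j v
    using coeff_along_line_scale[OF assms(1) c(1), of j u v] c by auto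
  then show ?thesis
    by (simp add: mult_vec_def)
qed

lemma tangent_cone_indep:
  assumes "homogeneous d F" "proj_rel u w"
  shows "\<exists>b. b \<noteq> 0 \<and> (\<forall>v. coeff (along_line F w v) j = b * coeff (along_line F u v) j)"
proof -
  obtain c where c: "c \<noteq> 0" "w = c *s u"
    using assms(2) by (auto simp: proj_rel_def)
  show ?thesis
    using coeff_along_line_scale[OF assms(1) c(1), of j u] c
    by (intro exI[of _ "c ^ d / c ^ j"]) (simp add: nonzero_eq_divide_eq mult.commute)
qed


subsection \<open>Arrangements\<close>

text \<open>
  The curves of an arrangement are given by the forms \<open>C i\<close> with \<open>i < k\<close>, and the divisor
  that is their sum is given by the product of these forms.
\<close>

definition arr_divisor :: "nat \<Rightarrow> (nat \<Rightarrow> poly3) \<Rightarrow> poly3" where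
  "arr_divisor k C = (\<Prod>i<k. C i)"

definition Sing :: "nat \<Rightarrow> (nat \<Rightarrow> poly3) \<Rightarrow> proj_plane set" where
  "Sing k C = (\<Union>i<k. singular_points (C i))
     \<union> {P. \<exists>i<k. \<exists>j<k. i \<noteq> j \<and> P \<in> curve_points (C i) \<and> P \<in> curve_points (C j)}"

definition d_arrangement :: "nat \<Rightarrow> nat \<Rightarrow> (nat \<Rightarrow> poly3) \<Rightarrow> bool" where
  "d_arrangement d k C \<longleftrightarrow>
     d \<ge> 1 \<and> k \<ge> 3 \<and>
     (\<forall>i<k. \<forall>j<k. i \<noteq> j \<longrightarrow> \<not> same_curve (C i) (C j)) \<and>
     (\<forall>i<k. smooth_curve d (C i)) \<and>
     (\<forall>P\<in>Sing k C. ordinary_singularity (arr_divisor k C) P) \<and>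
     (\<nexists>P. \<forall>i<k. P \<in> curve_points (C i))"

definition t_num :: "nat \<Rightarrow> (nat \<Rightarrow> poly3) \<Rightarrow> nat \<Rightarrow> nat" where
  "t_num k C r = card {P \<in> Sing k C. mult_at (arr_divisor k C) P = r}"

text \<open>
  For an arrangement \<open>Sing k C\<close> is finite and nonempty by Bezout's theorem, so that the
  conventions for infinite sums and for division by zero play no role.
\<close>

definition conf_seshadri :: "nat \<Rightarrow> (nat \<Rightarrow> poly3) \<Rightarrow> real" where
  "conf_seshadri k C =
     real (total_deg (arr_divisor k C)) / (\<Sum>P\<in>Sing k C. real (mult_at (arr_divisor k C) P))"

end

theory Submission
  imports Defs "Subresultants.Subresultant_Gcd" "HOL-Computational_Algebra.Field_as_Ring"
    "HOL-Computational_Algebra.Fundamental_Theorem_Algebra"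
begin

text \<open>
  Write \<open>r\<^sub>P\<close> for the number of curves of the arrangement through \<open>P\<close>. The curves are smooth, so
  \<open>Sing\<close> consists of the points with \<open>r\<^sub>P \<ge> 2\<close>, and the multiplicity of the divisor at \<open>P\<close> is
  \<open>r\<^sub>P\<close> (\<open>mult_at_arr_divisor\<close>). The claim asks for an upper bound on the sum of these
  multiplicities, and counting ordered pairs of curves through a point already gives one:
  \<open>\<Sum>r\<^sub>P \<le> \<Sum>r\<^sub>P (r\<^sub>P - 1) = \<Sum>\<^bsub>i \<noteq> j\<^esub> |C\<^sub>i \<inter> C\<^sub>j| \<le> k (k - 1) d\<^sup>2\<close>.
  This is at most \<open>d k (2 d k + 3 d / 2 - 9 / 2)\<close> because \<open>d k + 5 d / 2 \<ge> 9 / 2\<close> when \<open>d \<ge> 1\<close>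
  and \<open>k \<ge> 3\<close>. The sum is also positive, because two plane curves always meet (\<open>curves_meet\<close>).

  The geometry is in the bound \<open>|C\<^sub>i \<inter> C\<^sub>j| \<le> d\<^sup>2\<close>. It is obtained for curves that are transversal
  at each common point (\<open>weak_bezout\<close>), which also excludes common components. Transversality
  follows from the ordinariness of the singular points (\<open>ordinary_imp_transversal\<close>): if two curves
  had the same tangent at \<open>P\<close>, the tangent cone of the divisor would contain the square of a linear
  form.

  For the bound on the common points of curves of degrees \<open>m\<close> and \<open>n\<close>, project from a
  point \<open>e\<close> that lies on neither curve and on no line through two of the given common points. The
  resultant of the two equations along the lines through \<open>e\<close> is a form of degree \<open>m n\<close>
  in two variables that vanishes at the projection of every common point. If there were more than
  \<open>m n\<close> of them, it would vanish identically; the equations would then have a common factor, and at a zero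
  of this factor their differentials would be linearly dependent. The same form of degree \<open>m n > 0\<close>
  has a zero, and this yields a common point.
\<close>

text \<open>The symbol \<open>$\<close> is kept for the components of a vector in \<open>\<complex>\<^sup>3\<close>.\<close>

no_notation Matrix.vec_index (infixl "$" 100)


section \<open>Evaluation of forms and differentials\<close>

lemma poly_mapping_eq_sum_single:
  "F = (\<Sum>m\<in>Poly_Mapping.keys F. Poly_Mapping.single m (Poly_Mapping.lookup F m))"
  by (rule poly_mapping_eqI)
     (simp add: lookup_sum lookup_single when_def Poly_Mapping.not_in_keys_iff_lookup_eq_zero)

lemma eval3_superset:
  assumes "finite A" "Poly_Mapping.keys F \<subseteq> A"
  shows "eval3 F x =
    (\<Sum>m\<in>A. Poly_Mapping.lookup F m * (\<Prod>i\<in>UNIV. (x $ i) ^ Poly_Mapping.lookup m i))"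
  unfolding eval3_def using assms
  by (intro sum.mono_neutral_left) (auto simp: Poly_Mapping.not_in_keys_iff_lookup_eq_zero)

lemma eval3_zero [simp]: "eval3 0 x = 0"
  by (simp add: eval3_def)

lemma eval3_add: "eval3 (F + G) x = eval3 F x + eval3 G x"
proof -
  let ?A = "Poly_Mapping.keys F \<union> Poly_Mapping.keys G"
  have "Poly_Mapping.keys (F + G) \<subseteq> ?A"
    by (rule Poly_Mapping.keys_add)
  then show ?thesis
    by (simp add: eval3_superset[of ?A] lookup_add algebra_simps sum.distrib)
qed

lemma eval3_sum: "eval3 (\<Sum>a\<in>A. f a) x = (\<Sum>a\<in>A. eval3 (f a) x)"
  by (induction A rule: infinite_finite_induct) (simp_all add: eval3_add)

lemma eval3_single:
  "eval3 (Poly_Mapping.single m c) x = c * (\<Prod>i\<in>UNIV. (x $ i) ^ Poly_Mapping.lookup m i)"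
  by (simp add: eval3_superset[of "{m}"])

lemma eval3_one [simp]: "eval3 1 x = 1"
  using eval3_single[of 0 1 x] by simp

lemma eval3_mult: "eval3 (F * G) x = eval3 F x * eval3 G x"
proof -
  have "F * G =
      (\<Sum>m\<in>Poly_Mapping.keys F. Poly_Mapping.single m (Poly_Mapping.lookup F m)) *
      (\<Sum>n\<in>Poly_Mapping.keys G. Poly_Mapping.single n (Poly_Mapping.lookup G n))"
    by (simp flip: poly_mapping_eq_sum_single)
  also have "\<dots> = (\<Sum>m\<in>Poly_Mapping.keys F. \<Sum>n\<in>Poly_Mapping.keys G.
      Poly_Mapping.single (m + n) (Poly_Mapping.lookup F m * Poly_Mapping.lookup G n))"
    by (simp add: sum_product mult_single)
  finally have "eval3 (F * G) x = (\<Sum>m\<in>Poly_Mapping.keys F. \<Sum>n\<in>Poly_Mapping.keys G.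
      eval3 (Poly_Mapping.single (m + n) (Poly_Mapping.lookup F m * Poly_Mapping.lookup G n)) x)"
    by (simp only: eval3_sum)
  also have "\<dots> = eval3 F x * eval3 G x"
    unfolding eval3_single
    by (simp add: eval3_def sum_product lookup_add power_add prod.distrib mult_ac)
  finally show ?thesis .
qed

lemma eval3_prod: "eval3 (\<Prod>a\<in>A. f a) x = (\<Prod>a\<in>A. eval3 (f a) x)"
  by (induction A rule: infinite_finite_induct) (simp_all add: eval3_mult)

lemma poly_eqI_values:
  fixes p q :: "'a :: {comm_ring_1, ring_no_zero_divisors, ring_char_0} poly"
  assumes "\<And>t. poly p t = poly q t"
  shows "p = q"
  using assms by (metis poly_eq_poly_eq_iff ext)

lemma along_line_prod: "along_line (\<Prod>a\<in>A. f a) p v = (\<Prod>a\<in>A. along_line (f a) p v)"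
  by (rule poly_eqI_values) (simp add: poly_along_line eval3_prod poly_prod)

lemma coeff_along_line_0: "coeff (along_line F p v) 0 = eval3 F p"
  using poly_along_line[of F p v 0] by (simp add: poly_0_coeff_0)

lemma coeff_1_prod:
  fixes q :: "'b \<Rightarrow> 'a :: idom poly"
  shows "coeff (\<Prod>i\<in>A. q i) 1 = (\<Sum>i\<in>A. coeff (q i) 1 * (\<Prod>j\<in>A - {i}. coeff (q j) 0))"
proof -
  have "coeff p 1 = poly (pderiv p) 0" "coeff p 0 = poly p 0" for p :: "'a poly"
    by (simp_all add: poly_0_coeff_0 coeff_pderiv)
  then show ?thesis
    by (simp only: pderiv_prod poly_sum poly_prod poly_mult mult.commute)
qed

lemma coeff_1_linear_power:
  fixes a b :: "'a :: idom"
  shows "coeff ([:a, b:] ^ n) 1 = of_nat n * a ^ (n - 1) * b"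
proof -
  have "coeff ([:a, b:] ^ n) 1 = poly (pderiv ([:a, b:] ^ n)) 0"
    by (simp add: poly_0_coeff_0 coeff_pderiv)
  also have "\<dots> = of_nat n * a ^ (n - 1) * b"
    by (simp add: pderiv_power pderiv_pCons)
  finally show ?thesis .
qed

text \<open>
  This identifies the coefficient of order one with the differential: it is the chain rule for
  \<open>F (p + t v)\<close> at \<open>t = 0\<close>, done monomial by monomial.
\<close>

lemma coeff_along_line_1:
  "coeff (along_line F p v) 1 = (\<Sum>i\<in>UNIV. eval3 (pdiff i F) p * v $ i)"
proof -
  let ?l = Poly_Mapping.lookup
  have "eval3 (pdiff i F) p = (\<Sum>m\<in>Poly_Mapping.keys F. of_nat (?l m i) * ?l F m *
      (p $ i ^ (?l m i - 1) * (\<Prod>j\<in>UNIV - {i}. p $ j ^ ?l m j)))" for i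
    unfolding pdiff_def eval3_sum eval3_single
  proof (rule sum.cong[OF refl])
    fix m
    have "(\<Prod>j\<in>UNIV. p $ j ^ ?l (m - Poly_Mapping.single i 1) j) =
        p $ i ^ ?l (m - Poly_Mapping.single i 1) i *
        (\<Prod>j\<in>UNIV - {i}. p $ j ^ ?l (m - Poly_Mapping.single i 1) j)"
      by (rule prod.remove) auto
    also have "(\<Prod>j\<in>UNIV - {i}. p $ j ^ ?l (m - Poly_Mapping.single i 1) j) =
        (\<Prod>j\<in>UNIV - {i}. p $ j ^ ?l m j)"
      by (rule prod.cong) (auto simp: lookup_minus lookup_single)
    finally show "of_nat (?l m i) * ?l F m *
        (\<Prod>j\<in>UNIV. p $ j ^ ?l (m - Poly_Mapping.single i 1) j) =
      of_nat (?l m i) * ?l F m * (p $ i ^ (?l m i - 1) * (\<Prod>j\<in>UNIV - {i}. p $ j ^ ?l m j))"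
      by (simp add: lookup_minus lookup_single)
  qed
  moreover have "coeff (along_line F p v) 1 =
      (\<Sum>m\<in>Poly_Mapping.keys F. ?l F m * (\<Sum>i\<in>UNIV. of_nat (?l m i) *
        p $ i ^ (?l m i - 1) * v $ i * (\<Prod>j\<in>UNIV - {i}. p $ j ^ ?l m j)))"
    unfolding along_line_def Polynomial.coeff_sum Polynomial.coeff_smult coeff_1_prod
      coeff_1_linear_power
    by (simp add: coeff_0_power)
  moreover have "(\<Sum>m\<in>Poly_Mapping.keys F. ?l F m * (\<Sum>i\<in>UNIV. of_nat (?l m i) *
        p $ i ^ (?l m i - 1) * v $ i * (\<Prod>j\<in>UNIV - {i}. p $ j ^ ?l m j))) =
      (\<Sum>i\<in>UNIV. (\<Sum>m\<in>Poly_Mapping.keys F. of_nat (?l m i) * ?l F m *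
      (p $ i ^ (?l m i - 1) * (\<Prod>j\<in>UNIV - {i}. p $ j ^ ?l m j))) * v $ i)"
    unfolding sum_distrib_left sum_distrib_right by (subst sum.swap) (simp add: mult_ac)
  ultimately show ?thesis
    by simp
qed

section \<open>Vectors in general position\<close>

text \<open>
  A convenient class of functions for general position arguments: it contains forms, differentials
  and determinants with one free column, and such a function vanishes on a line either identically
  or at finitely many points.
\<close>

definition line_polynomial :: "(complex^3 \<Rightarrow> complex) \<Rightarrow> bool" where
  "line_polynomial f \<longleftrightarrow> (\<forall>p v. \<exists>q. \<forall>t. f (p + t *s v) = poly q t)"

lemma line_polynomial_eval3: "line_polynomial (eval3 F)"
  unfolding line_polynomial_def using poly_along_line by metis

lemma line_polynomial_linear:
  assumes "\<And>p v t. f (p + t *s v) = f p + t * f v"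
  shows "line_polynomial f"
  unfolding line_polynomial_def
proof (intro allI)
  fix p v
  show "\<exists>q. \<forall>t. f (p + t *s v) = poly q t"
    by (rule exI[of _ "[:f p, f v:]"]) (simp add: assms)
qed

text \<open>
  Given a good vector \<open>u\<close> for all but one of the functions and a good vector \<open>w\<close> for the last one,
  none of the functions vanishes identically on the line through \<open>u\<close> and \<open>w\<close>, so all but finitely
  many points of this line are good for all of them.
\<close>

lemma generic_vector:
  assumes "finite T" "\<And>f. f \<in> T \<Longrightarrow> line_polynomial f" "\<And>f. f \<in> T \<Longrightarrow> \<exists>x. f x \<noteq> 0"
  shows "\<exists>x. \<forall>f\<in>T. f x \<noteq> 0"
  using assms
proof (induction T)
  case empty
  then show ?case by simp
next
  case (insert f T)
  obtain u where u: "\<forall>g\<in>T. g u \<noteq> 0"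
    using insert by blast
  obtain w where w: "f w \<noteq> 0"
    using insert.prems(2) by blast
  have "\<exists>q. \<forall>t. g (u + t *s (w - u)) = poly q t" if "g \<in> insert f T" for g
    using insert.prems(1)[OF that] unfolding line_polynomial_def by blast
  then obtain q where q: "\<And>g t. g \<in> insert f T \<Longrightarrow> g (u + t *s (w - u)) = poly (q g) t"
    by metis
  have "q g \<noteq> 0" if "g \<in> insert f T" for g
  proof (cases "g = f")
    case True
    then show ?thesis using q[OF that, of 1] w by auto
  next
    case False
    then show ?thesis using q[OF that, of 0] u that by auto
  qed
  then have "finite (\<Union>g\<in>insert f T. {t. poly (q g) t = 0})"
    using insert.hyps(1) by (intro finite_UN_I) (auto intro: poly_roots_finite)
  then obtain t where "t \<notin> (\<Union>g\<in>insert f T. {t. poly (q g) t = 0})"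
    using ex_new_if_finite infinite_UNIV_char_0 by blast
  then show ?case
    using q by (intro exI[of _ "u + t *s (w - u)"]) auto
qed

text \<open>
  The determinant with the columns \<open>u\<close>, \<open>v\<close>, \<open>w\<close>, written out so that the identities below are
  ring identities in the coordinates.
\<close>

definition det3 :: "complex^3 \<Rightarrow> complex^3 \<Rightarrow> complex^3 \<Rightarrow> complex" where
  "det3 u v w = u$1 * (v$2 * w$3 - v$3 * w$2) - u$2 * (v$1 * w$3 - v$3 * w$1)
     + u$3 * (v$1 * w$2 - v$2 * w$1)"

lemma line_polynomial_det3:
  "line_polynomial (\<lambda>w. det3 u v w)" "line_polynomial (\<lambda>w. det3 u w v)"
  by (rule line_polynomial_linear; simp add: det3_def algebra_simps)+

lemma det3_swap: "det3 v u w = - det3 u v w" "det3 u w v = - det3 u v w"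
  by (simp_all add: det3_def algebra_simps)

lemma cramer3: "det3 a b c *s x = det3 x b c *s a + det3 a x c *s b + det3 a b x *s c"
  unfolding Finite_Cartesian_Product.vec_eq_iff forall_3 by (simp add: det3_def) (simp add: algebra_simps)

text \<open>
  A Pluecker relation. It shows that the points \<open>x\<close> and \<open>y\<close> have the same projection from \<open>c\<close> only
  if \<open>x\<close>, \<open>y\<close> and \<open>c\<close> are collinear.
\<close>

lemma plucker3:
  "det3 x y c * det3 a b c = det3 x b c * det3 a y c - det3 y b c * det3 a x c"
  by (simp add: det3_def) (simp add: algebra_simps)

lemma exists_det3_nonzero:
  assumes "u \<noteq> 0" "\<And>c. v \<noteq> c *s u"
  shows "\<exists>w. det3 u v w \<noteq> 0"
proof (rule ccontr)
  assume "\<not> ?thesis"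
  then have "det3 u v w = 0" for w
    by simp
  from this[of "axis 1 1"] this[of "axis 2 1"] this[of "axis 3 1"]
  have cross: "u$2 * v$3 = u$3 * v$2" "u$1 * v$3 = u$3 * v$1" "u$1 * v$2 = u$2 * v$1"
    by (simp_all add: det3_def axis_def)
  obtain i where i: "u $ i \<noteq> 0"
    using assms(1) by (auto simp: Finite_Cartesian_Product.vec_eq_iff)
  have "u $ i * v $ j = u $ j * v $ i" for j
    using cross exhaust_3[of i] exhaust_3[of j] by auto
  then have "v = (v $ i / u $ i) *s u"
    using i by (simp add: Finite_Cartesian_Product.vec_eq_iff field_simps)
  then show False
    using assms(2) by blast
qed

section \<open>Homogeneous forms along a line\<close>

lemma poly_eqI_nonzero_values:
  fixes p q :: "'a :: {idom, ring_char_0} poly"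
  assumes "\<And>t. t \<noteq> 0 \<Longrightarrow> poly p t = poly q t"
  shows "p = q"
proof -
  have "[:0, 1:] * p = [:0, 1:] * q"
    by (rule poly_eqI_values) (use assms in auto)
  then show ?thesis
    by simp
qed

lemma degree_along_line_le:
  assumes "homogeneous d F"
  shows "degree (along_line F p v) \<le> d"
  unfolding along_line_def
proof (rule degree_sum_le)
  fix m assume m: "m \<in> Poly_Mapping.keys F"
  have "degree (\<Prod>i\<in>UNIV. [:p $ i, v $ i:] ^ Poly_Mapping.lookup m i) \<le>
      (\<Sum>i\<in>UNIV. degree ([:p $ i, v $ i:] ^ Poly_Mapping.lookup m i))"
    using degree_prod_sum_le[of UNIV "\<lambda>i. [:p $ i, v $ i:] ^ Poly_Mapping.lookup m i"]
    by (simp add: o_def)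
  also have "\<dots> \<le> (\<Sum>i\<in>UNIV. Poly_Mapping.lookup m i)"
  proof (rule sum_mono)
    fix i
    have "degree ([:p $ i, v $ i:] ^ Poly_Mapping.lookup m i)
        \<le> degree [:p $ i, v $ i:] * Poly_Mapping.lookup m i"
      by (rule degree_power_le)
    also have "\<dots> \<le> Poly_Mapping.lookup m i"
      by simp
    finally show "degree ([:p $ i, v $ i:] ^ Poly_Mapping.lookup m i) \<le> Poly_Mapping.lookup m i" .
  qed
  also have "\<dots> = d"
    using assms m by (simp add: homogeneous_def monom_deg_def)
  finally show "degree (Polynomial.smult (Poly_Mapping.lookup F m)
      (\<Prod>i\<in>UNIV. [:p $ i, v $ i:] ^ Poly_Mapping.lookup m i)) \<le> d"
    using degree_smult_le le_trans by blast
qed simp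

text \<open>
  Exchanging the base point and the direction reverses the coefficients, because
  \<open>F (p + t v) = t\<^sup>d F (v + p / t)\<close>.
\<close>

lemma coeff_along_line_swap:
  assumes "homogeneous d F" "j \<le> d"
  shows "coeff (along_line F p v) j = coeff (along_line F v p) (d - j)"
proof -
  define q where "q = (\<Sum>i\<le>d. monom (coeff (along_line F v p) (d - i)) i)"
  have "along_line F p v = q"
  proof (rule poly_eqI_nonzero_values)
    fix t :: complex assume t: "t \<noteq> 0"
    have "p + t *s v = t *s (v + inverse t *s p)"
      using t by (simp add: Finite_Cartesian_Product.vec_eq_iff algebra_simps)
    then have "poly (along_line F p v) t = t ^ d * poly (along_line F v p) (inverse t)"
      by (simp only: poly_along_line eval3_scale[OF assms(1)])
    also have "\<dots> = (\<Sum>i\<le>d. coeff (along_line F v p) i * (t ^ d * inverse t ^ i))"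
    proof -
      have "poly (along_line F v p) (inverse t) =
          poly (\<Sum>i\<le>d. monom (coeff (along_line F v p) i) i) (inverse t)"
        by (simp add: poly_as_sum_of_monoms'[OF degree_along_line_le[OF assms(1)]])
      then show ?thesis
        by (simp add: poly_sum poly_monom sum_distrib_left mult_ac)
    qed
    also have "\<dots> = (\<Sum>i\<le>d. coeff (along_line F v p) i * t ^ (d - i))"
      using t by (intro sum.cong) (auto simp: power_diff field_simps)
    also have "\<dots> = (\<Sum>i\<le>d. coeff (along_line F v p) (d - i) * t ^ i)"
      by (rule sum.reindex_bij_witness[of _ "\<lambda>i. d - i" "\<lambda>i. d - i"]) auto
    also have "\<dots> = poly q t"
      by (simp add: q_def poly_sum poly_monom)
    finally show "poly (along_line F p v) t = poly q t" .
  qed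
  then show ?thesis
    using assms(2) by (simp add: q_def Polynomial.coeff_sum)
qed

lemma coeff_along_line_top:
  assumes "homogeneous d F"
  shows "coeff (along_line F p v) d = eval3 F v"
  using coeff_along_line_swap[OF assms, of d p v] by (simp add: coeff_along_line_0)

lemma degree_along_line:
  assumes "homogeneous d F" "eval3 F v \<noteq> 0"
  shows "degree (along_line F p v) = d"
  using assms degree_along_line_le coeff_along_line_top le_degree
  by (metis order_antisym)

definition differential :: "poly3 \<Rightarrow> complex^3 \<Rightarrow> complex^3 \<Rightarrow> complex" where
  "differential F p v = coeff (along_line F p v) 1"

lemma differential_eq_sum: "differential F p v = (\<Sum>i\<in>UNIV. eval3 (pdiff i F) p * v $ i)"
  by (simp add: differential_def coeff_along_line_1 del: One_nat_def)

lemma differential_add: "differential F p (v + w) = differential F p v + differential F p w"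
  by (simp add: differential_eq_sum algebra_simps sum.distrib)

lemma differential_scale: "differential F p (c *s v) = c * differential F p v"
  by (simp add: differential_eq_sum algebra_simps sum_distrib_left)

lemma line_polynomial_differential: "line_polynomial (differential F p)"
  by (rule line_polynomial_linear) (simp add: differential_add differential_scale)

lemma differential_axis: "differential F p (axis i 1) = eval3 (pdiff i F) p"
  by (simp add: differential_eq_sum axis_def if_distrib cong: if_cong)

text \<open>
  \<open>F (p + t p) = (1 + t)\<^sup>d F (p)\<close>, and the coefficient of \<open>t\<close> is read off.
\<close>

lemma euler_relation:
  assumes "homogeneous d F"
  shows "differential F p p = of_nat d * eval3 F p"
proof -
  have "along_line F p p = Polynomial.smult (eval3 F p) ([:1, 1:] ^ d)"
  proof (rule poly_eqI_values)
    fix t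
    have "p + t *s p = (1 + t) *s p"
      by (simp add: Finite_Cartesian_Product.vec_eq_iff algebra_simps)
    then show "poly (along_line F p p) t = poly (Polynomial.smult (eval3 F p) ([:1, 1:] ^ d)) t"
      by (simp only: poly_along_line eval3_scale[OF assms]) simp
  qed
  then show ?thesis
    by (simp only: differential_def Polynomial.coeff_smult coeff_1_linear_power) simp
qed

lemma differential_base_scale:
  assumes "homogeneous d F" "c \<noteq> 0"
  shows "c * differential F (c *s p) v = c ^ d * differential F p v"
  using coeff_along_line_scale[OF assms, of 1 p v] by (simp add: differential_def)

section \<open>The resultant of two forms along the lines through a point\<close>

text \<open>
  The matrices differ by row and column scalings, but dividing by the powers of \<open>c\<close> is avoided, so
  that \<open>c\<close> need not be a unit.
\<close>

lemma det_scale: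
  fixes A B :: "'a :: idom mat"
  assumes "A \<in> carrier_mat n n" "B \<in> carrier_mat n n"
    and "\<And>i j. i < n \<Longrightarrow> j < n \<Longrightarrow> c ^ s i * B $$ (i, j) = c ^ t j * A $$ (i, j)"
  shows "c ^ (\<Sum>i<n. s i) * Determinant.det B = c ^ (\<Sum>j<n. t j) * Determinant.det A"
proof -
  have "c ^ (\<Sum>i<n. s i) * (signof \<pi> * (\<Prod>i = 0..<n. B $$ (i, \<pi> i))) =
      c ^ (\<Sum>j<n. t j) * (signof \<pi> * (\<Prod>i = 0..<n. A $$ (i, \<pi> i)))"
    if \<pi>: "\<pi> permutes {0..<n}" for \<pi>
  proof -
    have "c ^ (\<Sum>i<n. s i) * (\<Prod>i = 0..<n. B $$ (i, \<pi> i)) =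
        (\<Prod>i = 0..<n. c ^ s i * B $$ (i, \<pi> i))"
      by (simp add: power_sum prod.distrib atLeast0LessThan)
    also have "\<dots> = (\<Prod>i = 0..<n. c ^ t (\<pi> i) * A $$ (i, \<pi> i))"
      using \<pi> permutes_in_image[OF \<pi>] by (intro prod.cong) (auto intro!: assms(3))
    also have "\<dots> = (\<Prod>i = 0..<n. c ^ t (\<pi> i)) * (\<Prod>i = 0..<n. A $$ (i, \<pi> i))"
      by (simp add: prod.distrib)
    also have "(\<Prod>i = 0..<n. c ^ t (\<pi> i)) = (\<Prod>i = 0..<n. c ^ t i)"
      using prod.permute[OF \<pi>, of "\<lambda>i. c ^ t i"] by (simp add: o_def)
    also have "\<dots> = c ^ (\<Sum>j<n. t j)"
      by (simp add: power_sum atLeast0LessThan)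
    finally show ?thesis
      by (simp add: mult_ac)
  qed
  then show ?thesis
    unfolding det_def'[OF assms(1)] det_def'[OF assms(2)] sum_distrib_left
    by (intro sum.cong) auto
qed

text \<open>
  The weights of the columns and of the rows of a Sylvester matrix. Their difference is the degree
  of the resultant of two forms.
\<close>

lemma sylvester_weight_sum:
  fixes m n :: nat
  shows "(\<Sum>j<m + n. j) = m * n + (\<Sum>i<m + n. if i < n then i else i - n)"
proof (induction m)
  case 0
  then show ?case by (auto intro: sum.cong)
next
  case (Suc m)
  then show ?case by simp
qed

text \<open>
  The line with direction \<open>e\<close> through \<open>q\<close> is parametrised, and the equations of the two curves are
  eliminated against each other on it. If \<open>e\<close> is on neither curve, this is a form of degree
  \<open>m n\<close> in \<open>q\<close>.
\<close>

definition line_resultant :: "poly3 \<Rightarrow> poly3 \<Rightarrow> complex^3 \<Rightarrow> complex^3 \<Rightarrow> complex" where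
  "line_resultant F G e q = resultant (along_line F q e) (along_line G q e)"

text \<open>
  Replacing \<open>q\<close> by \<open>c q\<close> multiplies the coefficient of order \<open>j\<close> of an equation of degree \<open>m\<close> by
  \<open>c\<^bsup>m - j\<^esup>\<close>. On the Sylvester matrix this is a scaling of the rows and columns.
\<close>

lemma line_resultant_scale:
  assumes F: "homogeneous m F" "eval3 F e \<noteq> 0" and G: "homogeneous n G" "eval3 G e \<noteq> 0"
    and c: "c \<noteq> 0"
  shows "line_resultant F G e (c *s q) = c ^ (m * n) * line_resultant F G e q"
proof -
  let ?A = "sylvester_mat_sub m n (along_line F q e) (along_line G q e)"
  let ?B = "sylvester_mat_sub m n (along_line F (c *s q) e) (along_line G (c *s q) e)"
  \<comment> \<open>The first \<open>n\<close> rows hold the coefficients of \<open>F\<close>, the other \<open>m\<close> rows those of \<open>G\<close>.\<close>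
  define s where "s i = (if i < n then i else i - n)" for i
  have "c ^ s i * ?B $$ (i, j) = c ^ j * ?A $$ (i, j)" if ij: "i < m + n" "j < m + n" for i j
  proof (cases "i < n")
    case True
    show ?thesis
    proof (cases "i \<le> j \<and> j - i \<le> m")
      case in_band: True
      have "c ^ (m + i - j) * (c ^ s i * ?B $$ (i, j)) =
          c ^ i * (c ^ (m + i - j) * coeff (along_line F (c *s q) e) (m + i - j))"
        using True in_band ij by (simp add: sylvester_mat_sub_index s_def)
      also have "\<dots> = c ^ (i + m) * coeff (along_line F q e) (m + i - j)"
        by (simp add: coeff_along_line_scale[OF F(1) c] power_add)
      also have "i + m = (m + i - j) + j"
        using in_band by auto
      also have "c ^ \<dots> * coeff (along_line F q e) (m + i - j) =
          c ^ (m + i - j) * (c ^ j * ?A $$ (i, j))"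
        using True in_band ij by (simp only: power_add) (simp add: sylvester_mat_sub_index)
      finally show ?thesis
        using c by simp
    next
      case not_in_band: False
      then show ?thesis
        using True ij by (auto simp: sylvester_mat_sub_index)
    qed
  next
    case False
    show ?thesis
    proof (cases "i - n \<le> j \<and> j \<le> i")
      case in_band: True
      have "c ^ (i - j) * (c ^ s i * ?B $$ (i, j)) =
          c ^ (i - n) * (c ^ (i - j) * coeff (along_line G (c *s q) e) (i - j))"
        using False in_band ij by (simp add: sylvester_mat_sub_index s_def)
      also have "\<dots> = c ^ (i - n + n) * coeff (along_line G q e) (i - j)"
        unfolding power_add by (simp add: coeff_along_line_scale[OF G(1) c])
      also have "i - n + n = (i - j) + j"
        using in_band False by auto
      also have "c ^ \<dots> * coeff (along_line G q e) (i - j) =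
          c ^ (i - j) * (c ^ j * ?A $$ (i, j))"
        using False in_band ij by (simp only: power_add) (simp add: sylvester_mat_sub_index)
      finally show ?thesis
        using c by simp
    next
      case not_in_band: False
      then show ?thesis
        using False ij by (auto simp: sylvester_mat_sub_index)
    qed
  qed
  then have "c ^ (\<Sum>i<m + n. s i) * Determinant.det ?B = c ^ (\<Sum>j<m + n. j) * Determinant.det ?A"
    by (intro det_scale sylvester_mat_sub_carrier) blast
  then have "Determinant.det ?B = c ^ (m * n) * Determinant.det ?A"
    using c by (simp add: sylvester_weight_sum s_def power_add)
  then show ?thesis
    by (simp add: line_resultant_def resultant_def sylvester_mat_def
        degree_along_line[OF F] degree_along_line[OF G])
qed

text \<open>
  The hypothesis excludes \<open>p = q = 0\<close>: the Sylvester matrix is then empty and has determinant \<open>1\<close>.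
\<close>

lemma resultant_eq_0_iff_common_root:
  fixes p q :: "complex poly"
  assumes "p \<noteq> 0"
  shows "resultant p q = 0 \<longleftrightarrow> (\<exists>y. poly p y = 0 \<and> poly q y = 0)"
proof
  assume "resultant p q = 0"
  then have "degree (gcd p q) > 0"
    by (simp add: resultant_0_gcd)
  then obtain y where "poly (gcd p q) y = 0"
    using alg_closed_imp_poly_has_root by blast
  then show "\<exists>y. poly p y = 0 \<and> poly q y = 0"
    by (meson dvd_trans gcd_dvd1 gcd_dvd2 poly_eq_0_iff_dvd)
next
  assume "\<exists>y. poly p y = 0 \<and> poly q y = 0"
  then obtain y where "[:- y, 1:] dvd gcd p q"
    by (auto simp: poly_eq_0_iff_dvd)
  moreover have "gcd p q \<noteq> 0"
    using assms by simp
  ultimately have "degree [:- y, 1:] \<le> degree (gcd p q)"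
    by (rule dvd_imp_degree_le)
  then show "resultant p q = 0"
    by (simp add: resultant_0_gcd)
qed

text \<open>
  The polynomial \<open>F (a + x b + y e)\<close> as a polynomial in \<open>y\<close> over the polynomials in \<open>x\<close>. For
  independent \<open>a\<close>, \<open>b\<close>, \<open>e\<close> it is the equation of the curve in an affine chart whose vertical lines
  pass through the point \<open>e\<close>.
\<close>

definition plane_poly :: "poly3 \<Rightarrow> complex^3 \<Rightarrow> complex^3 \<Rightarrow> complex^3 \<Rightarrow> complex poly poly" where
  "plane_poly F a b e =
     (\<Sum>m\<in>Poly_Mapping.keys F.
        [:[:Poly_Mapping.lookup F m:]:] *
        (\<Prod>i\<in>UNIV. [:[:a $ i, b $ i:], [:e $ i:]:] ^ Poly_Mapping.lookup m i))"

lemma poly_plane_poly: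
  "poly (poly (plane_poly F a b e) [:y:]) x = eval3 F (a + x *s b + y *s e)"
  by (simp add: plane_poly_def eval3_def poly_sum poly_prod mult_ac add_ac)

lemma poly_map_poly_eval:
  "poly (map_poly (\<lambda>c. poly c x) P) y = poly (poly P [:y:]) x"
  by (induction P) (auto simp: map_poly_pCons)

lemma map_poly_plane_poly:
  "map_poly (\<lambda>c. poly c x) (plane_poly F a b e) = along_line F (a + x *s b) e"
  by (rule poly_eqI_values) (simp only: poly_map_poly_eval poly_plane_poly poly_along_line)

lemma poly_coeff_plane_poly:
  "poly (coeff (plane_poly F a b e) j) x = coeff (along_line F (a + x *s b) e) j"
  by (simp flip: map_poly_plane_poly)

lemma coeff_plane_poly_top:
  assumes "homogeneous d F"
  shows "coeff (plane_poly F a b e) d = [:eval3 F e:]"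
  by (rule poly_eqI_values) (simp add: poly_coeff_plane_poly coeff_along_line_top[OF assms])

text \<open>
  When \<open>e\<close> is not on the curve, the leading coefficient in \<open>y\<close> is the constant \<open>F (e)\<close>. Hence the
  degree does not drop under specialisation of \<open>x\<close>, and resultants commute with specialisation.
\<close>

lemma degree_plane_poly:
  assumes "homogeneous d F" "eval3 F e \<noteq> 0"
  shows "degree (plane_poly F a b e) = d"
proof (rule order_antisym)
  show "degree (plane_poly F a b e) \<le> d"
  proof (rule degree_le, intro allI impI)
    fix j assume "d < j"
    then have "coeff (along_line F (a + x *s b) e) j = 0" for x
      using degree_along_line_le[OF assms(1)] coeff_eq_0 le_less_trans by blast
    then show "coeff (plane_poly F a b e) j = 0"
      by (intro poly_eqI_values) (simp add: poly_coeff_plane_poly)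
  qed
  show "d \<le> degree (plane_poly F a b e)"
    by (rule le_degree) (simp add: coeff_plane_poly_top[OF assms(1)] assms(2))
qed

lemma poly_resultant_plane_poly:
  assumes F: "homogeneous m F" "eval3 F e \<noteq> 0" and G: "homogeneous n G" "eval3 G e \<noteq> 0"
  shows "poly (resultant (plane_poly F a b e) (plane_poly G a b e)) x =
    line_resultant F G e (a + x *s b)"
  unfolding line_resultant_def map_poly_plane_poly[symmetric]
  by (rule poly_hom.resultant_map_poly[symmetric])
     (simp_all add: map_poly_plane_poly degree_plane_poly[OF F] degree_plane_poly[OF G]
        degree_along_line[OF F] degree_along_line[OF G])

text \<open>
  Exchanging \<open>a\<close> and \<open>b\<close> passes to the chart at infinity on the pencil of lines through \<open>e\<close>. The
  factor \<open>x\<^bsup>m n\<^esup>\<close> is what remains of homogeneity in the two charts.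
\<close>

lemma poly_resultant_plane_poly_swap:
  assumes F: "homogeneous m F" "eval3 F e \<noteq> 0" and G: "homogeneous n G" "eval3 G e \<noteq> 0"
    and x: "x \<noteq> 0"
  shows "poly (resultant (plane_poly F a b e) (plane_poly G a b e)) x =
    x ^ (m * n) * poly (resultant (plane_poly F b a e) (plane_poly G b a e)) (inverse x)"
proof -
  have "a + x *s b = x *s (b + inverse x *s a)"
    using x by (simp add: Finite_Cartesian_Product.vec_eq_iff algebra_simps)
  then show ?thesis
    by (simp only: poly_resultant_plane_poly[OF F G] line_resultant_scale[OF F G x])
qed

text \<open>
  A polynomial \<open>R\<close> with \<open>R (x) = x\<^sup>N S (1 / x)\<close> for a polynomial \<open>S\<close> has degree at most \<open>N\<close>.
\<close>

lemma degree_resultant_plane_poly: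
  assumes F: "homogeneous m F" "eval3 F e \<noteq> 0" and G: "homogeneous n G" "eval3 G e \<noteq> 0"
  shows "degree (resultant (plane_poly F a b e) (plane_poly G a b e)) \<le> m * n"
proof -
  let ?R = "resultant (plane_poly F a b e) (plane_poly G a b e)"
  let ?S = "resultant (plane_poly F b a e) (plane_poly G b a e)"
  show ?thesis
  proof (cases "?R = 0")
    case False
    have eq: "monom 1 (degree ?S) * ?R = monom 1 (m * n) * reflect_poly ?S"
      by (rule poly_eqI_nonzero_values)
         (simp add: poly_monom poly_reflect_poly_nz poly_resultant_plane_poly_swap[OF F G, of _ a b])
    with False have "reflect_poly ?S \<noteq> 0"
      by (metis monom_eq_0_iff mult_eq_0_iff mult_zero_right zero_neq_one)
    with eq False have "degree ?S + degree ?R = m * n + degree (reflect_poly ?S)"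
      by (metis degree_mult_eq degree_monom_eq monom_eq_0_iff zero_neq_one)
    then show ?thesis
      using degree_reflect_poly_le[of ?S] by linarith
  qed simp
qed

section \<open>Two plane curves meet\<close>

lemma det3_0 [simp]: "det3 0 v w = 0"
  by (simp add: det3_def)

lemma exists_det3_nonzero_pair:
  assumes "e \<noteq> 0"
  shows "\<exists>a b. det3 a b e \<noteq> 0"
proof -
  have "det3 (axis 2 1) (axis 3 1) e = e $ 1" "det3 (axis 3 1) (axis 1 1) e = e $ 2"
    "det3 (axis 1 1) (axis 2 1) e = e $ 3"
    by (simp_all add: det3_def axis_def)
  moreover have "e $ 1 \<noteq> 0 \<or> e $ 2 \<noteq> 0 \<or> e $ 3 \<noteq> 0"
    using assms by (simp add: Finite_Cartesian_Product.vec_eq_iff forall_3)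
  ultimately show ?thesis
    by metis
qed

lemma common_zero_of_resultant_root:
  assumes F: "homogeneous m F" "eval3 F e \<noteq> 0" and G: "homogeneous n G" "eval3 G e \<noteq> 0"
    and indep: "det3 a b e \<noteq> 0"
    and root: "poly (resultant (plane_poly F a b e) (plane_poly G a b e)) x = 0"
  shows "\<exists>p. p \<noteq> 0 \<and> eval3 F p = 0 \<and> eval3 G p = 0"
proof -
  let ?q = "a + x *s b"
  have "coeff (along_line F ?q e) m \<noteq> 0"
    using F by (simp add: coeff_along_line_top)
  then have "along_line F ?q e \<noteq> 0"
    by auto
  moreover have "resultant (along_line F ?q e) (along_line G ?q e) = 0"
    using root by (simp add: poly_resultant_plane_poly[OF F G] line_resultant_def)
  ultimately obtain y where "eval3 F (?q + y *s e) = 0" "eval3 G (?q + y *s e) = 0"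
    by (auto simp: resultant_eq_0_iff_common_root poly_along_line)
  moreover have "det3 (?q + y *s e) b e = det3 a b e"
    by (simp add: det3_def algebra_simps)
  then have "?q + y *s e \<noteq> 0"
    using indep by auto
  ultimately show ?thesis
    by blast
qed

lemma homogeneous_eval3_0:
  assumes "homogeneous d F" "d > 0"
  shows "eval3 F 0 = 0"
  using eval3_scale[OF assms(1), of 0 0] assms(2) by (simp add: power_0_left)

text \<open>
  If the resultant had a root in neither of the two charts of the pencil of lines through \<open>e\<close>, it
  would be a nonzero constant in both, and then \<open>x\<^bsup>m n\<^esup>\<close> would be constant.
\<close>

lemma forms_have_common_zero:
  assumes F: "homogeneous m F" "\<exists>x. eval3 F x \<noteq> 0" and G: "homogeneous n G" "\<exists>x. eval3 G x \<noteq> 0"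
    and "m > 0" "n > 0"
  shows "\<exists>p. p \<noteq> 0 \<and> eval3 F p = 0 \<and> eval3 G p = 0"
proof -
  obtain e where "\<forall>f\<in>{eval3 F, eval3 G}. f e \<noteq> 0"
    using generic_vector[of "{eval3 F, eval3 G}"] F(2) G(2) line_polynomial_eval3 by blast
  then have e: "eval3 F e \<noteq> 0" "eval3 G e \<noteq> 0"
    by auto
  then have "e \<noteq> 0"
    using homogeneous_eval3_0[OF F(1) \<open>m > 0\<close>] by auto
  then obtain a b where ab: "det3 a b e \<noteq> 0"
    using exists_det3_nonzero_pair by blast
  let ?R = "resultant (plane_poly F a b e) (plane_poly G a b e)"
  let ?S = "resultant (plane_poly F b a e) (plane_poly G b a e)"
  have "(\<exists>x. poly ?R x = 0) \<or> (\<exists>x. poly ?S x = 0)"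
  proof (rule ccontr)
    assume "\<not> ?thesis"
    then have no_root: "\<And>x. poly ?R x \<noteq> 0" "\<And>x. poly ?S x \<noteq> 0"
      by auto
    then have "degree ?R = 0" "degree ?S = 0"
      using alg_closed_imp_poly_has_root by blast+
    then obtain r s where rs: "?R = [:r:]" "?S = [:s:]"
      by (meson degree_eq_zeroE)
    have "r = x ^ (m * n) * s" if "x \<noteq> 0" for x
      using poly_resultant_plane_poly_swap[OF F(1) e(1) G(1) e(2) that, of a b] rs by simp
    from this[of 1] this[of 2] have "s = 2 ^ (m * n) * s"
      by simp
    moreover have "s \<noteq> 0"
      using no_root(2)[of 0] rs by simp
    ultimately have "(2 :: complex) ^ (m * n) = 1"
      by simp
    then have "norm ((2 :: complex) ^ (m * n)) = 1"
      by simp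
    then have "(2 :: real) ^ (m * n) = 1"
      by (simp add: norm_power)
    moreover have "(1 :: real) < 2 ^ (m * n)"
      using assms(5,6) by (intro one_less_power) auto
    ultimately show False
      by simp
  qed
  moreover have "det3 b a e \<noteq> 0"
    using ab by (simp add: det3_swap(1)[of a b])
  ultimately show ?thesis
    using common_zero_of_resultant_root[OF F(1) e(1) G(1) e(2)] ab by blast
qed

section \<open>Transversal intersections\<close>

definition transversal :: "poly3 \<Rightarrow> poly3 \<Rightarrow> complex^3 \<Rightarrow> bool" where
  "transversal F G p \<longleftrightarrow>
     (\<forall>r s. (\<forall>v. r * differential F p v + s * differential G p v = 0) \<longrightarrow> r = 0 \<and> s = 0)"

text \<open>
  A direction in the affine chart is given by its slopes \<open>\<beta>\<close> and \<open>\<gamma>\<close>. Restriction to a line is a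
  ring homomorphism, so that a factorisation of \<open>plane_poly\<close> can be differentiated in every
  direction of the chart.
\<close>

definition restrict_to_line ::
    "complex \<Rightarrow> complex \<Rightarrow> complex \<Rightarrow> complex \<Rightarrow> complex poly poly \<Rightarrow> complex poly" where
  "restrict_to_line x \<beta> y \<gamma> P = poly (map_poly (\<lambda>c. pcompose c [:x, \<beta>:]) P) [:y, \<gamma>:]"

lemma poly_restrict_to_line:
  "poly (restrict_to_line x \<beta> y \<gamma> P) t = poly (poly P [:y + t * \<gamma>:]) (x + t * \<beta>)"
  unfolding restrict_to_line_def
  by (induction P) (auto simp: map_poly_pCons poly_pcompose algebra_simps)

lemma restrict_to_line_mult:
  "restrict_to_line x \<beta> y \<gamma> (P * Q) = restrict_to_line x \<beta> y \<gamma> P * restrict_to_line x \<beta> y \<gamma> Q"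
  by (rule poly_eqI_values) (simp add: poly_restrict_to_line)

lemma coeff_0_restrict_to_line:
  "coeff (restrict_to_line x \<beta> y \<gamma> P) 0 = poly (poly P [:y:]) x"
  by (simp flip: poly_0_coeff_0 add: poly_restrict_to_line)

lemma restrict_to_line_plane_poly:
  "restrict_to_line x \<beta> y \<gamma> (plane_poly F a b e) =
    along_line F (a + x *s b + y *s e) (\<beta> *s b + \<gamma> *s e)"
proof (rule poly_eqI_values)
  fix t
  have "a + (x + t * \<beta>) *s b + (y + t * \<gamma>) *s e =
      a + x *s b + y *s e + t *s (\<beta> *s b + \<gamma> *s e)"
    by (simp add: Finite_Cartesian_Product.vec_eq_iff algebra_simps)
  then show "poly (restrict_to_line x \<beta> y \<gamma> (plane_poly F a b e)) t =
      poly (along_line F (a + x *s b + y *s e) (\<beta> *s b + \<gamma> *s e)) t"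
    by (simp only: poly_restrict_to_line poly_plane_poly poly_along_line)
qed

text \<open>
  Let \<open>H\<close> be a common factor of positive degree, with \<open>F = H A\<close> and \<open>G = H B\<close> in the chart. At a
  zero of \<open>H\<close> the product rule gives \<open>dF = A dH\<close> and \<open>dG = B dH\<close> in the directions of the chart,
  and in the remaining direction, that of the point itself, both differentials vanish by Euler's
  relation.
\<close>

lemma resultant_0_imp_not_transversal:
  assumes F: "homogeneous m F" "eval3 F e \<noteq> 0" and G: "homogeneous n G" "eval3 G e \<noteq> 0"
    and indep: "det3 a b e \<noteq> 0"
    and zero: "resultant (plane_poly F a b e) (plane_poly G a b e) = 0"
  shows "\<exists>p. p \<noteq> 0 \<and> eval3 F p = 0 \<and> eval3 G p = 0 \<and> \<not> transversal F G p"
proof -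
  define H where "H = gcd (plane_poly F a b e) (plane_poly G a b e)"
  have "degree H \<noteq> 0"
    using zero by (simp add: H_def resultant_0_gcd)
  obtain A where A: "plane_poly F a b e = H * A"
    unfolding H_def by (meson gcd_dvd1 dvdE)
  obtain B where B: "plane_poly G a b e = H * B"
    unfolding H_def by (meson gcd_dvd2 dvdE)
  \<comment> \<open>Above a generic \<open>x\<close> the specialised factor still has positive degree, hence a root.\<close>
  have "lead_coeff H \<noteq> 0"
    using \<open>degree H \<noteq> 0\<close> by auto
  then obtain x where x: "poly (lead_coeff H) x \<noteq> 0"
    by (metis poly_eqI_values poly_0)
  have "degree (map_poly (\<lambda>c. poly c x) H) \<ge> degree H"
    using x by (intro le_degree) simp
  then obtain y where "poly (map_poly (\<lambda>c. poly c x) H) y = 0"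
    using alg_closed_imp_poly_has_root \<open>degree H \<noteq> 0\<close> by (metis le_zero_eq not_gr_zero)
  then have H0: "poly (poly H [:y:]) x = 0"
    by (simp add: poly_map_poly_eval)
  define p where "p = a + x *s b + y *s e"
  have Fp: "eval3 F p = 0" and Gp: "eval3 G p = 0"
    using poly_plane_poly[of F a b e y x] poly_plane_poly[of G a b e y x] A B H0
    by (simp_all add: p_def)
  have det_p: "det3 p b e = det3 a b e"
    by (simp add: p_def det3_def algebra_simps)
  then have "p \<noteq> 0"
    using indep by auto
  define A0 B0 where "A0 = poly (poly A [:y:]) x" and "B0 = poly (poly B [:y:]) x"
  define h where "h \<beta> \<gamma> = coeff (restrict_to_line x \<beta> y \<gamma> H) 1" for \<beta> \<gamma>
  have plane: "differential F p (\<beta> *s b + \<gamma> *s e) = h \<beta> \<gamma> * A0"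
      "differential G p (\<beta> *s b + \<gamma> *s e) = h \<beta> \<gamma> * B0" for \<beta> \<gamma>
  proof -
    let ?r = "restrict_to_line x \<beta> y \<gamma>"
    have "along_line F p (\<beta> *s b + \<gamma> *s e) = ?r H * ?r A"
      "along_line G p (\<beta> *s b + \<gamma> *s e) = ?r H * ?r B"
      unfolding p_def restrict_to_line_plane_poly[symmetric] A B restrict_to_line_mult by simp_all
    then show "differential F p (\<beta> *s b + \<gamma> *s e) = h \<beta> \<gamma> * A0"
      "differential G p (\<beta> *s b + \<gamma> *s e) = h \<beta> \<gamma> * B0"
      by (simp_all add: differential_def coeff_mult coeff_0_restrict_to_line H0 A0_def B0_def h_def)
  qed
  have all: "\<exists>c. differential F p v = c * A0 \<and> differential G p v = c * B0" for v
  proof -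
    let ?\<Delta> = "det3 p b e"
    define \<alpha> \<beta> \<gamma> where "\<alpha> = det3 v b e / ?\<Delta>" and "\<beta> = det3 p v e / ?\<Delta>"
      and "\<gamma> = det3 p b v / ?\<Delta>"
    have "?\<Delta> *s v = ?\<Delta> *s (\<alpha> *s p + (\<beta> *s b + \<gamma> *s e))"
      using indep det_p cramer3[of p b e v]
      by (simp add: \<alpha>_def \<beta>_def \<gamma>_def Finite_Cartesian_Product.vec_eq_iff field_simps)
    then have v: "v = \<alpha> *s p + (\<beta> *s b + \<gamma> *s e)"
      using indep det_p by (metis vector_mul_lcancel)
    have "differential F p p = 0" "differential G p p = 0"
      by (simp_all add: euler_relation[OF F(1)] euler_relation[OF G(1)] Fp Gp)
    then have "differential F p v = h \<beta> \<gamma> * A0 \<and> differential G p v = h \<beta> \<gamma> * B0"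
      by (simp only: v differential_add[of _ _ "\<alpha> *s p"] differential_scale[of _ _ \<alpha>] plane)
         simp
    then show ?thesis
      by blast
  qed
  have "\<not> transversal F G p"
  proof (cases "A0 = 0 \<and> B0 = 0")
    case True
    then have "\<forall>v. 1 * differential F p v + 0 * differential G p v = 0"
      using all by (metis add_0 mult_zero_left mult_zero_right mult_1)
    then show ?thesis
      unfolding transversal_def by (metis zero_neq_one)
  next
    case False
    have "\<forall>v. B0 * differential F p v + - A0 * differential G p v = 0"
    proof
      fix v
      show "B0 * differential F p v + - A0 * differential G p v = 0"
        using all[of v] by auto
    qed
    then show ?thesis
      using False unfolding transversal_def by (metis neg_equal_0_iff_equal)
  qed
  then show ?thesis
    using \<open>p \<noteq> 0\<close> Fp Gp by blast
qed

text \<open>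
  The elements of \<open>S\<close> represent distinct points of the plane. The centre \<open>e\<close> is chosen such that
  distinct elements of \<open>S\<close> lie on distinct lines through \<open>e\<close>, and \<open>b\<close> such that no element lies at
  infinity in the chart. The elements of \<open>S\<close> then give distinct roots of the resultant.
\<close>

lemma card_common_zeros_le:
  assumes F: "homogeneous m F" "\<exists>x. eval3 F x \<noteq> 0" and G: "homogeneous n G" "\<exists>x. eval3 G x \<noteq> 0"
    and trans: "\<And>p. p \<noteq> 0 \<Longrightarrow> eval3 F p = 0 \<Longrightarrow> eval3 G p = 0 \<Longrightarrow> transversal F G p"
    and S: "finite S" "\<And>p. p \<in> S \<Longrightarrow> p \<noteq> 0 \<and> eval3 F p = 0 \<and> eval3 G p = 0"
    and distinct_points: "\<And>p q c. p \<in> S \<Longrightarrow> q \<in> S \<Longrightarrow> p \<noteq> q \<Longrightarrow> q \<noteq> c *s p"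
  shows "card S \<le> m * n"
proof (cases "S = {}")
  case False
  then obtain a where a: "a \<in> S"
    by blast
  let ?T = "{eval3 F, eval3 G} \<union> (\<lambda>(p, q). det3 p q) ` {(p, q) \<in> S \<times> S. p \<noteq> q}"
  have "\<exists>e. \<forall>f\<in>?T. f e \<noteq> 0"
  proof (rule generic_vector)
    show "finite ?T"
      using finite_subset[of "{(p, q) \<in> S \<times> S. p \<noteq> q}" "S \<times> S"] S(1) by auto
    show "line_polynomial f" if "f \<in> ?T" for f
      using that line_polynomial_eval3 line_polynomial_det3(1) by auto
    show "\<exists>x. f x \<noteq> 0" if "f \<in> ?T" for f
      using that F(2) G(2) exists_det3_nonzero S(2) distinct_points by auto
  qed
  then obtain e where "\<forall>f\<in>?T. f e \<noteq> 0"
    by blast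
  then have e: "eval3 F e \<noteq> 0" "eval3 G e \<noteq> 0"
    and off_lines: "\<And>p q. p \<in> S \<Longrightarrow> q \<in> S \<Longrightarrow> p \<noteq> q \<Longrightarrow> det3 p q e \<noteq> 0"
    by auto
  have "\<exists>b. \<forall>f\<in>(\<lambda>p w. det3 p w e) ` S. f b \<noteq> 0"
  proof (rule generic_vector)
    show "finite ((\<lambda>p w. det3 p w e) ` S)"
      using S(1) by simp
    show "line_polynomial f" if "f \<in> (\<lambda>p w. det3 p w e) ` S" for f
      using that line_polynomial_det3(2) by auto
    show "\<exists>x. f x \<noteq> 0" if f: "f \<in> (\<lambda>p w. det3 p w e) ` S" for f
    proof -
      obtain p where p: "p \<in> S" "f = (\<lambda>w. det3 p w e)"
        using f by blast
      have "e \<noteq> c *s p" for c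
        using e(1) S(2)[OF p(1)] by (auto simp: eval3_scale[OF F(1)])
      then obtain w where "det3 p e w \<noteq> 0"
        using exists_det3_nonzero S(2)[OF p(1)] by blast
      then show ?thesis
        using p(2) det3_swap(2)[of p e w] by (intro exI[of _ w]) simp
    qed
  qed
  then obtain b where b: "\<And>p. p \<in> S \<Longrightarrow> det3 p b e \<noteq> 0"
    by auto
  \<comment> \<open>By Cramer's rule this is the abscissa of \<open>p\<close>: a multiple of \<open>p\<close> is \<open>a + x p *s b + y *s e\<close>.\<close>
  define x where "x p = det3 a p e / det3 p b e" for p
  let ?R = "resultant (plane_poly F a b e) (plane_poly G a b e)"
  have "?R \<noteq> 0"
    using resultant_0_imp_not_transversal[OF F(1) e(1) G(1) e(2) b[OF a]] trans by blast
  have "inj_on x S"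
  proof (rule inj_onI, rule ccontr)
    fix p q assume pq: "p \<in> S" "q \<in> S" "x p = x q" "p \<noteq> q"
    then have "det3 p b e * det3 a q e - det3 q b e * det3 a p e = 0"
      using b by (simp add: x_def field_simps)
    then have "det3 p q e * det3 a b e = 0"
      by (simp only: plucker3[of p q e a b])
    then show False
      using off_lines pq b[OF a] by auto
  qed
  then have "card S = card (x ` S)"
    by (simp add: card_image)
  also have "\<dots> \<le> card {t. poly ?R t = 0}"
  proof (rule card_mono)
    show "finite {t. poly ?R t = 0}"
      using \<open>?R \<noteq> 0\<close> by (rule poly_roots_finite)
    show "x ` S \<subseteq> {t. poly ?R t = 0}"
    proof
      fix t assume "t \<in> x ` S"
      then obtain p where p: "p \<in> S" "t = x p"
        by blast
      let ?q = "a + t *s b"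
      define y where "y = det3 a b p / det3 p b e"
      define c where "c = det3 a b e / det3 p b e"
      have "det3 p b e *s (c *s p) = det3 p b e *s (?q + y *s e)"
        using cramer3[of a b e p] b[OF p(1)]
        by (simp add: c_def y_def p(2) x_def Finite_Cartesian_Product.vec_eq_iff field_simps)
      then have "c *s p = ?q + y *s e"
        using b[OF p(1)] by (metis vector_mul_lcancel)
      then have "poly (along_line F ?q e) y = 0" "poly (along_line G ?q e) y = 0"
        using S(2)[OF p(1)] unfolding poly_along_line
        by (metis F(1) eval3_scale mult_zero_right, metis G(1) eval3_scale mult_zero_right)
      moreover have "coeff (along_line F ?q e) m \<noteq> 0"
        using e(1) by (simp add: coeff_along_line_top[OF F(1)])
      then have "along_line F ?q e \<noteq> 0"
        by auto
      ultimately show "t \<in> {t. poly ?R t = 0}"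
        by (auto simp: poly_resultant_plane_poly[OF F(1) e(1) G(1) e(2)] line_resultant_def
            resultant_eq_0_iff_common_root)
    qed
  qed
  also have "\<dots> \<le> degree ?R"
    using \<open>?R \<noteq> 0\<close> by (rule poly_roots_degree)
  also have "\<dots> \<le> m * n"
    by (rule degree_resultant_plane_poly[OF F(1) e(1) G(1) e(2)])
  finally show ?thesis .
qed simp

section \<open>Intersections in the projective plane\<close>

lemma rep_proj_plane_nonzero: "rep_proj_plane P \<noteq> 0"
  using rep_proj_plane_rel[of P] by (simp add: proj_rel_def)

lemma rep_proj_plane_eqI:
  assumes "rep_proj_plane Q = c *s rep_proj_plane P"
  shows "P = Q"
proof -
  have "c \<noteq> 0"
    using assms rep_proj_plane_nonzero[of Q] by auto
  then have "proj_rel (rep_proj_plane P) (rep_proj_plane Q)"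
    using assms rep_proj_plane_nonzero[of P] by (auto simp: proj_rel_def)
  then show ?thesis
    by (simp add: Quotient3_rel_rep[OF Quotient3_proj_plane])
qed

lemma exists_rep_proj_plane:
  assumes "p \<noteq> 0"
  shows "\<exists>P c. c \<noteq> 0 \<and> rep_proj_plane P = c *s p"
proof -
  have "proj_rel p p"
    using assms by (auto simp: proj_rel_def intro!: exI[of _ 1])
  then have "proj_rel (rep_proj_plane (abs_proj_plane p)) p"
    by (rule Quotient3_rep_abs[OF Quotient3_proj_plane])
  then have "proj_rel p (rep_proj_plane (abs_proj_plane p))"
    using part_equivp_symp[OF proj_rel_part_equivp] by blast
  then show ?thesis
    by (auto simp: proj_rel_def)
qed

lemma transversal_scale:
  assumes F: "homogeneous m F" and G: "homogeneous n G" and c: "c \<noteq> 0"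
    and trans: "transversal F G (c *s p)"
  shows "transversal F G p"
  unfolding transversal_def
proof (intro allI impI)
  fix r s assume rs: "\<forall>v. r * differential F p v + s * differential G p v = 0"
  have "c * ((r * c ^ n) * differential F (c *s p) v + (s * c ^ m) * differential G (c *s p) v) =
      c ^ (m + n) * (r * differential F p v + s * differential G p v)" for v
  proof -
    have "c * ((r * c ^ n) * differential F (c *s p) v + (s * c ^ m) * differential G (c *s p) v) =
        r * c ^ n * (c * differential F (c *s p) v) + s * c ^ m * (c * differential G (c *s p) v)"
      by (simp add: algebra_simps)
    then show ?thesis
      by (simp only: differential_base_scale[OF F c] differential_base_scale[OF G c])
         (simp add: power_add algebra_simps)
  qed
  then have "\<forall>v. (r * c ^ n) * differential F (c *s p) v + (s * c ^ m) * differential G (c *s p) v = 0"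
    using rs c by simp
  then have "r * c ^ n = 0 \<and> s * c ^ m = 0"
    using trans unfolding transversal_def by blast
  then show "r = 0 \<and> s = 0"
    using c by simp
qed

text \<open>
  Bezout's inequality. Transversality replaces the usual hypothesis that the curves have no common
  component. Since the affine bound applies to every finite set of common points, finiteness comes
  out together with the bound.
\<close>

lemma weak_bezout:
  assumes F: "homogeneous m F" "\<exists>x. eval3 F x \<noteq> 0" and G: "homogeneous n G" "\<exists>x. eval3 G x \<noteq> 0"
    and trans: "\<And>P. P \<in> curve_points F \<inter> curve_points G \<Longrightarrow> transversal F G (rep_proj_plane P)"
  shows "finite (curve_points F \<inter> curve_points G) \<and> card (curve_points F \<inter> curve_points G) \<le> m * n"
proof -
  have trans_vec: "transversal F G p" if p: "p \<noteq> 0" "eval3 F p = 0" "eval3 G p = 0" for p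
  proof -
    obtain P c where "c \<noteq> 0" "rep_proj_plane P = c *s p"
      using exists_rep_proj_plane[OF p(1)] by blast
    then show ?thesis
      using trans[of P] p transversal_scale[OF F(1) G(1)]
      by (auto simp: curve_points_def eval3_scale[OF F(1)] eval3_scale[OF G(1)])
  qed
  have "card X \<le> m * n" if X: "X \<subseteq> curve_points F \<inter> curve_points G" "finite X" for X
  proof -
    have "inj_on rep_proj_plane X"
      by (rule inj_onI) (metis rep_proj_plane_eqI vector_smult_lid)
    then have "card X = card (rep_proj_plane ` X)"
      by (simp add: card_image)
    also have "\<dots> \<le> m * n"
    proof (rule card_common_zeros_le[OF F G trans_vec])
      show "p \<noteq> 0 \<and> eval3 F p = 0 \<and> eval3 G p = 0" if "p \<in> rep_proj_plane ` X" for p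
        using that X rep_proj_plane_nonzero by (auto simp: curve_points_def)
      show "q \<noteq> c *s p" if "p \<in> rep_proj_plane ` X" "q \<in> rep_proj_plane ` X" "p \<noteq> q" for p q c
        using that by (auto dest: rep_proj_plane_eqI)
    qed (use X in auto)
    finally show ?thesis .
  qed
  then show ?thesis
    by (intro finite_if_finite_subsets_card_bdd) blast
qed

lemma curves_meet:
  assumes F: "homogeneous m F" "\<exists>x. eval3 F x \<noteq> 0" and G: "homogeneous n G" "\<exists>x. eval3 G x \<noteq> 0"
    and "m > 0" "n > 0"
  shows "curve_points F \<inter> curve_points G \<noteq> {}"
proof -
  obtain p where p: "p \<noteq> 0" "eval3 F p = 0" "eval3 G p = 0"
    using forms_have_common_zero[OF assms] by blast
  obtain P c where "rep_proj_plane P = c *s p"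
    using exists_rep_proj_plane[OF p(1)] by blast
  then have "P \<in> curve_points F \<inter> curve_points G"
    using p by (simp add: curve_points_def eval3_scale[OF F(1)] eval3_scale[OF G(1)])
  then show ?thesis
    by blast
qed

section \<open>The divisor of an arrangement of smooth curves\<close>

lemma smooth_curve_differential:
  assumes "smooth_curve d F" "P \<in> curve_points F"
  shows "\<exists>v. differential F (rep_proj_plane P) v \<noteq> 0"
proof -
  have "P \<notin> singular_points F"
    using assms(1) by (simp add: smooth_curve_def)
  then obtain i where "eval3 (pdiff i F) (rep_proj_plane P) \<noteq> 0"
    using assms(2) by (auto simp: singular_points_def)
  then show ?thesis
    by (intro exI[of _ "axis i 1"]) (simp add: differential_axis)
qed

text \<open>
  A form that vanishes everywhere has vanishing differentials, so every point of its zero set would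
  be singular.
\<close>

lemma smooth_curve_nonzero_value:
  assumes "smooth_curve d F"
  shows "\<exists>x. eval3 F x \<noteq> 0"
proof (rule ccontr)
  assume "\<not> ?thesis"
  then have zero: "eval3 F x = 0" for x
    by simp
  then have "along_line F p v = 0" for p v
    by (intro poly_eqI_values) (simp add: poly_along_line)
  then show False
    using smooth_curve_differential[OF assms, of undefined]
    by (simp add: curve_points_def zero differential_def)
qed

text \<open>
  The lowest term of a product of polynomials with at most simple zeros at the origin. It computes
  both the multiplicity and the tangent cone of a union of smooth curves.
\<close>

lemma coeff_prod_simple_zeros:
  fixes q :: "'b \<Rightarrow> 'a :: idom poly"
  assumes "finite A"
  defines "I \<equiv> {i \<in> A. coeff (q i) 0 = 0}"
  shows "j < card I \<Longrightarrow> coeff (\<Prod>i\<in>A. q i) j = 0"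
    and "coeff (\<Prod>i\<in>A. q i) (card I) = (\<Prod>i\<in>I. coeff (q i) 1) * (\<Prod>i\<in>A - I. coeff (q i) 0)"
proof -
  have "\<exists>r. q i = monom 1 1 * r" if "i \<in> I" for i
  proof -
    have "[:- 0, 1:] dvd q i"
      using that by (subst poly_eq_0_iff_dvd[symmetric]) (simp add: poly_0_coeff_0 I_def)
    moreover have "monom 1 1 = [:- 0, 1 :: 'a:]"
      by (simp add: monom_Suc monom_0)
    ultimately show ?thesis
      by (metis dvdE)
  qed
  then obtain r where r: "\<And>i. i \<in> I \<Longrightarrow> q i = monom 1 1 * r i"
    by metis
  have "(\<Prod>i\<in>A. q i) = (\<Prod>i\<in>I. q i) * (\<Prod>i\<in>A - I. q i)"
    by (rule prod.subset_diff[of I A q, THEN trans]) (use assms in \<open>auto simp: mult.commute\<close>)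
  also have "(\<Prod>i\<in>I. q i) = monom 1 (card I) * (\<Prod>i\<in>I. r i)"
    by (simp add: r prod.distrib monom_power)
  finally have prod_eq: "(\<Prod>i\<in>A. q i) = monom 1 (card I) * ((\<Prod>i\<in>I. r i) * (\<Prod>i\<in>A - I. q i))"
    by (simp add: mult.assoc)
  show "coeff (\<Prod>i\<in>A. q i) j = 0" if "j < card I"
    using that by (simp add: prod_eq coeff_monom_mult)
  have coeff_0_prod: "coeff (\<Prod>i\<in>B. f i) 0 = (\<Prod>i\<in>B. coeff (f i) 0)" for f :: "'b \<Rightarrow> 'a poly" and B
    by (simp flip: poly_0_coeff_0 add: poly_prod)
  have "coeff (q i) 1 = coeff (r i) 0" if "i \<in> I" for i
    using r[OF that] by (simp add: coeff_monom_mult)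
  then show "coeff (\<Prod>i\<in>A. q i) (card I) =
      (\<Prod>i\<in>I. coeff (q i) 1) * (\<Prod>i\<in>A - I. coeff (q i) 0)"
    by (simp add: prod_eq coeff_monom_mult coeff_mult_0 coeff_0_prod)
qed

definition curves_through :: "nat \<Rightarrow> (nat \<Rightarrow> poly3) \<Rightarrow> proj_plane \<Rightarrow> nat set" where
  "curves_through k C P = {i. i < k \<and> P \<in> curve_points (C i)}"

lemma finite_curves_through [simp]: "finite (curves_through k C P)"
  by (simp add: curves_through_def)

lemma arr_divisor_low_coeffs:
  fixes P v C k
  defines "p \<equiv> rep_proj_plane P" and "I \<equiv> curves_through k C P"
  shows "j < card I \<Longrightarrow> coeff (along_line (arr_divisor k C) p v) j = 0"
    and "coeff (along_line (arr_divisor k C) p v) (card I) =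
      (\<Prod>i\<in>I. differential (C i) p v) * (\<Prod>i\<in>{..<k} - I. eval3 (C i) p)"
proof -
  have I: "I = {i \<in> {..<k}. coeff (along_line (C i) p v) 0 = 0}"
    by (auto simp: I_def p_def curves_through_def curve_points_def coeff_along_line_0)
  have expand: "along_line (arr_divisor k C) p v = (\<Prod>i<k. along_line (C i) p v)"
    by (simp add: arr_divisor_def along_line_prod)
  show "coeff (along_line (arr_divisor k C) p v) j = 0" if "j < card I"
    using that coeff_prod_simple_zeros(1)[of "{..<k}" j "\<lambda>i. along_line (C i) p v"]
    by (simp add: expand I)
  show "coeff (along_line (arr_divisor k C) p v) (card I) =
      (\<Prod>i\<in>I. differential (C i) p v) * (\<Prod>i\<in>{..<k} - I. eval3 (C i) p)"
    using coeff_prod_simple_zeros(2)[of "{..<k}" "\<lambda>i. along_line (C i) p v"]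
    unfolding expand by (simp add: I differential_def coeff_along_line_0)
qed

text \<open>
  The tangent cone candidate in degree \<open>r\<^sub>P\<close> is a product of nonzero differentials and nonzero
  values, so it does not vanish in a generic direction.
\<close>

lemma mult_at_arr_divisor:
  assumes smooth: "\<And>i. i < k \<Longrightarrow> smooth_curve d (C i)"
  shows "mult_at (arr_divisor k C) P = card (curves_through k C P)"
proof -
  let ?p = "rep_proj_plane P" and ?I = "curves_through k C P"
  have "\<exists>v. \<forall>f\<in>(\<lambda>i. differential (C i) ?p) ` ?I. f v \<noteq> 0"
    by (rule generic_vector)
       (auto simp: line_polynomial_differential curves_through_def
         intro!: smooth_curve_differential[OF smooth])
  then obtain v where "\<forall>i\<in>?I. differential (C i) ?p v \<noteq> 0"
    by auto
  then have "coeff (along_line (arr_divisor k C) ?p v) (card ?I) \<noteq> 0"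
    unfolding arr_divisor_low_coeffs(2) by (auto simp: curves_through_def curve_points_def)
  then show ?thesis
    unfolding mult_at_def mult_vec_def
    by (intro Least_equality) (auto intro: leI dest: arr_divisor_low_coeffs(1))
qed

lemma tangent_cone_arr_divisor:
  assumes smooth: "\<And>i. i < k \<Longrightarrow> smooth_curve d (C i)"
  shows "tangent_cone (arr_divisor k C) P v =
    (\<Prod>i\<in>curves_through k C P. differential (C i) (rep_proj_plane P) v) *
    (\<Prod>i\<in>{..<k} - curves_through k C P. eval3 (C i) (rep_proj_plane P))"
proof -
  have "mult_at (arr_divisor k C) P = card (curves_through k C P)"
    using smooth by (rule mult_at_arr_divisor)
  then show ?thesis
    by (simp only: tangent_cone_def arr_divisor_low_coeffs(2))
qed

text \<open>
  The hypothesis on \<open>a m * b n\<close> says that the factors have pairwise distinct roots, so that every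
  root of the product is simple.
\<close>

lemma prod_linear_simple_root:
  fixes a b :: "nat \<Rightarrow> 'a :: field"
  assumes b: "\<And>m. m < l \<Longrightarrow> b m \<noteq> 0"
    and distinct_roots: "\<And>m n. m < l \<Longrightarrow> n < l \<Longrightarrow> m \<noteq> n \<Longrightarrow> a m * b n \<noteq> a n * b m"
    and root: "poly (\<Prod>m<l. [:a m, b m:]) t = 0"
  shows "poly (pderiv (\<Prod>m<l. [:a m, b m:])) t \<noteq> 0"
proof -
  obtain m where m: "m < l" "a m + t * b m = 0"
    using root by (auto simp: poly_prod)
  have other: "a n + t * b n \<noteq> 0" if n: "n < l" "n \<noteq> m" for n
  proof
    assume "a n + t * b n = 0"
    then have "a n = - t * b n" "a m = - t * b m"
      using m(2) by (simp_all add: add_eq_0_iff2)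
    then have "a m * b n = a n * b m"
      by simp
    then show False
      using distinct_roots m(1) n by metis
  qed
  have "poly (pderiv (\<Prod>n<l. [:a n, b n:])) t =
      (\<Sum>n<l. (\<Prod>i\<in>{..<l} - {n}. a i + t * b i) * b n)"
    by (simp add: pderiv_prod poly_sum poly_prod pderiv_pCons mult.commute)
  also have "\<dots> = (\<Prod>i\<in>{..<l} - {m}. a i + t * b i) * b m"
  proof (subst sum.remove[of _ m])
    have "(\<Prod>i\<in>{..<l} - {n}. a i + t * b i) * b n = 0" if "n \<noteq> m" for n
      using that m by auto
    then have "(\<Sum>n\<in>{..<l} - {m}. (\<Prod>i\<in>{..<l} - {n}. a i + t * b i) * b n) = 0"
      by (intro sum.neutral) blast
    then show "(\<Prod>i\<in>{..<l} - {m}. a i + t * b i) * b m +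
        (\<Sum>n\<in>{..<l} - {m}. (\<Prod>i\<in>{..<l} - {n}. a i + t * b i) * b n) =
        (\<Prod>i\<in>{..<l} - {m}. a i + t * b i) * b m"
      by (simp only: add_0_right)
  qed (use m in auto)
  also have "\<dots> \<noteq> 0"
    using other b[OF m(1)] by auto
  finally show ?thesis .
qed

text \<open>
  Suppose that the differentials of two of the curves are proportional. On a generic line in the
  tangent space, the product of linear forms required by ordinariness has only simple roots,
  because the forms are pairwise independent. The tangent cone of the divisor, however, has the
  two proportional differentials as factors, and thus a double root where they vanish.
\<close>

lemma ordinary_imp_transversal:
  assumes smooth: "\<And>i. i < k \<Longrightarrow> smooth_curve d (C i)"
    and ord: "ordinary_singularity (arr_divisor k C) P"
    and ij: "i \<in> curves_through k C P" "j \<in> curves_through k C P" "i \<noteq> j"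
  shows "transversal (C i) (C j) (rep_proj_plane P)"
proof (rule ccontr)
  let ?p = "rep_proj_plane P" and ?I = "curves_through k C P"
  define D where "D i = differential (C i) ?p" for i
  assume "\<not> transversal (C i) (C j) ?p"
  then obtain r s where rs: "\<And>v. r * D i v + s * D j v = 0" "r \<noteq> 0 \<or> s \<noteq> 0"
    by (auto simp: transversal_def D_def)
  have nonzero: "\<exists>v. D n v \<noteq> 0" if "n \<in> ?I" for n
    using that smooth_curve_differential[OF smooth] by (auto simp: curves_through_def D_def)
  have "r \<noteq> 0" "s \<noteq> 0"
    using rs nonzero[OF ij(1)] nonzero[OF ij(2)] by force+
  have same_kernel: "D j v = 0" if "D i v = 0" for v
    using rs(1)[of v] that \<open>s \<noteq> 0\<close> by simp
  obtain l :: nat and L where L: "\<And>m n c. m < l \<Longrightarrow> n < l \<Longrightarrow> m \<noteq> n \<Longrightarrow> L m \<noteq> c *s L n"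
    and l: "l \<ge> 2"
    and cone: "\<And>v. tangent_cone (arr_divisor k C) P v = (\<Prod>m<l. \<Sum>a\<in>UNIV. L m $ a * v $ a)"
    using ord unfolding ordinary_singularity_def by blast
  define f where "f m v = (\<Sum>a\<in>UNIV. L m $ a * v $ a)" for m v
  have f_linear: "f m (v + t *s w) = f m v + t * f m w" for m v w t
    by (simp add: f_def algebra_simps sum.distrib sum_distrib_left)
  have f_line_polynomial: "line_polynomial (f m)" for m
    by (rule line_polynomial_linear) (rule f_linear)
  have f_axis: "f m (axis a 1) = L m $ a" for m a
    by (simp add: f_def axis_def if_distrib cong: if_cong)
  have L_nonzero: "L m \<noteq> 0" if m: "m < l" for m
  proof -
    define n :: nat where "n = (if m = 0 then 1 else 0)"
    have "n < l" "m \<noteq> n"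
      using l by (auto simp: n_def)
    then show ?thesis
      using L[OF m, of n 0] by auto
  qed
  \<comment> \<open>The direction \<open>w\<close> and then the base point \<open>u\<close> of a generic line \<open>u + t w\<close> are chosen.\<close>
  obtain w where "\<forall>g\<in>insert (D i) (f ` {..<l}). g w \<noteq> 0"
  proof -
    have "\<exists>w. \<forall>g\<in>insert (D i) (f ` {..<l}). g w \<noteq> 0"
    proof (rule generic_vector)
      show "line_polynomial g" if "g \<in> insert (D i) (f ` {..<l})" for g
        using that line_polynomial_differential f_line_polynomial by (auto simp: D_def)
      show "\<exists>x. g x \<noteq> 0" if g: "g \<in> insert (D i) (f ` {..<l})" for g
      proof (cases "g = D i")
        case False
        then obtain m where m: "m < l" "g = f m"
          using g by auto
        then obtain a where "L m $ a \<noteq> 0"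
          using L_nonzero by (auto simp: Finite_Cartesian_Product.vec_eq_iff)
        then show ?thesis
          using f_axis m by metis
      qed (use nonzero ij in auto)
    qed auto
    then show ?thesis
      using that by blast
  qed
  then have w: "D i w \<noteq> 0" "\<And>m. m < l \<Longrightarrow> f m w \<noteq> 0"
    by auto
  let ?g = "\<lambda>(m, n) v. f m v * f n w - f n v * f m w"
  let ?pairs = "{(m, n) \<in> {..<l} \<times> {..<l}. m \<noteq> n}"
  obtain u where "\<forall>g\<in>?g ` ?pairs. g u \<noteq> 0"
  proof -
    have "\<exists>u. \<forall>g\<in>?g ` ?pairs. g u \<noteq> 0"
    proof (rule generic_vector)
      show "finite (?g ` ?pairs)"
        using finite_subset[of ?pairs "{..<l} \<times> {..<l}"] by auto
      show "line_polynomial g" if "g \<in> ?g ` ?pairs" for g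
        using that by (auto intro!: line_polynomial_linear simp: f_linear algebra_simps)
      show "\<exists>x. g x \<noteq> 0" if g: "g \<in> ?g ` ?pairs" for g
      proof (rule ccontr)
        obtain m n where mn: "m < l" "n < l" "m \<noteq> n" "g = ?g (m, n)"
          using g by auto
        assume "\<not> ?thesis"
        then have "g (axis a 1) = 0" for a
          by simp
        then have "L m $ a * f n w = L n $ a * f m w" for a
          using mn(4) by (simp add: f_axis)
        then have "L m = (f m w / f n w) *s L n"
          using w(2)[OF mn(2)] by (simp add: Finite_Cartesian_Product.vec_eq_iff field_simps)
        then show False
          using L mn by blast
      qed
    qed
    then show ?thesis
      using that by blast
  qed
  then have u: "f m u * f n w \<noteq> f n u * f m w" if "m < l" "n < l" "m \<noteq> n" for m n
    using that by force
  have D_linear: "D n (v + t *s w) = D n v + t * D n w" for n v w t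
    by (simp only: D_def differential_add differential_scale)
  define t where "t = - D i u / D i w"
  define rest where "rest = Polynomial.smult (\<Prod>n\<in>{..<k} - ?I. eval3 (C n) ?p)
    (\<Prod>n\<in>?I - {i} - {j}. [:D n u, D n w:])"
  have prod_eq: "(\<Prod>m<l. [:f m u, f m w:]) = [:D i u, D i w:] * [:D j u, D j w:] * rest"
  proof (rule poly_eqI_values)
    fix x
    have "poly (\<Prod>m<l. [:f m u, f m w:]) x = tangent_cone (arr_divisor k C) P (u + x *s w)"
      by (simp only: cone f_def[symmetric] f_linear poly_prod) simp
    also have "\<dots> = (\<Prod>n\<in>?I. D n (u + x *s w)) * (\<Prod>n\<in>{..<k} - ?I. eval3 (C n) ?p)"
      unfolding D_def using smooth by (rule tangent_cone_arr_divisor)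
    also have "(\<Prod>n\<in>?I. D n (u + x *s w)) = D i (u + x *s w) * (D j (u + x *s w) *
        (\<Prod>n\<in>?I - {i} - {j}. D n (u + x *s w)))"
      using ij by (subst prod.remove[of _ i], simp, simp, subst prod.remove[of _ j]) auto
    finally show "poly (\<Prod>m<l. [:f m u, f m w:]) x =
        poly ([:D i u, D i w:] * [:D j u, D j w:] * rest) x"
      by (simp only: D_linear rest_def poly_prod poly_mult Polynomial.poly_smult poly_pCons poly_0
          mult_zero_left mult_zero_right add_0_right mult_ac)
  qed
  have "D i (u + t *s w) = 0"
    using w(1) by (simp only: D_linear) (simp add: t_def)
  then have roots: "poly [:D i u, D i w:] t = 0" "poly [:D j u, D j w:] t = 0"
    using same_kernel[of "u + t *s w"] by (simp_all add: D_linear)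
  have "poly (\<Prod>m<l. [:f m u, f m w:]) t = 0" "poly (pderiv (\<Prod>m<l. [:f m u, f m w:])) t = 0"
    unfolding prod_eq
    by (simp_all only: pderiv_mult poly_mult poly_add roots mult_zero_left mult_zero_right add_0)
  then show False
    using prod_linear_simple_root[of l "\<lambda>m. f m w" "\<lambda>m. f m u" t] w(2) u by blast
qed

section \<open>Degrees and the count of incident pairs\<close>

lemma homogeneous_mult:
  assumes "homogeneous a F" "homogeneous b G"
  shows "homogeneous (a + b) (F * G)"
  unfolding homogeneous_def
proof
  fix m assume "m \<in> Poly_Mapping.keys (F * G)"
  then obtain x y where "x \<in> Poly_Mapping.keys F" "y \<in> Poly_Mapping.keys G" "m = x + y"
    using keys_mult by blast
  then show "monom_deg m = a + b"
    using assms by (simp add: homogeneous_def monom_deg_def lookup_add sum.distrib)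
qed

lemma homogeneous_arr_divisor:
  assumes "\<And>i. i < k \<Longrightarrow> homogeneous d (C i)"
  shows "homogeneous (d * k) (arr_divisor k C)"
  using assms
proof (induction k)
  case 0
  then show ?case
    by (simp add: arr_divisor_def homogeneous_def monom_deg_def)
next
  case (Suc k)
  then show ?case
    using homogeneous_mult[of "d * k" "arr_divisor k C" d "C k"]
    by (simp add: arr_divisor_def add.commute)
qed

lemma total_deg_homogeneous:
  assumes "homogeneous d F" "F \<noteq> 0"
  shows "total_deg F = d"
proof -
  have "monom_deg ` Poly_Mapping.keys F = {d}"
    using assms by (auto simp: homogeneous_def image_iff ex_in_conv)
  then show ?thesis
    by (simp add: total_deg_def)
qed

lemma total_deg_arr_divisor:
  assumes "\<And>i. i < k \<Longrightarrow> smooth_curve d (C i)"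
  shows "total_deg (arr_divisor k C) = d * k"
proof (rule total_deg_homogeneous)
  show "homogeneous (d * k) (arr_divisor k C)"
    using assms by (intro homogeneous_arr_divisor) (auto simp: smooth_curve_def plane_curve_def)
  have "\<exists>x. \<forall>f\<in>(\<lambda>i. eval3 (C i)) ` {..<k}. f x \<noteq> 0"
    using assms smooth_curve_nonzero_value
    by (intro generic_vector) (auto simp: line_polynomial_eval3)
  then obtain x where "\<forall>i<k. eval3 (C i) x \<noteq> 0"
    by auto
  then have "eval3 (arr_divisor k C) x \<noteq> 0"
    by (simp add: arr_divisor_def eval3_prod)
  then show "arr_divisor k C \<noteq> 0"
    by auto
qed

text \<open>
  Every curve through a point of \<open>S\<close> has a partner there, so it is the first member of an ordered
  pair of distinct curves through the point. The sum is therefore at most the number of incidences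
  of points with such pairs, which is then counted pair by pair.
\<close>

lemma sum_multiplicities_le_pairs:
  fixes I :: "'p \<Rightarrow> nat set"
  assumes S: "finite S" and I: "\<And>P. P \<in> S \<Longrightarrow> I P \<subseteq> {..<k}"
    and two: "\<And>P. P \<in> S \<Longrightarrow> \<exists>i\<in>I P. \<exists>j\<in>I P. i \<noteq> j"
    and pair: "\<And>i j. i < k \<Longrightarrow> j < k \<Longrightarrow> i \<noteq> j \<Longrightarrow> card {P \<in> S. i \<in> I P \<and> j \<in> I P} \<le> N"
  shows "(\<Sum>P\<in>S. card (I P)) \<le> k * (k - 1) * N"
proof -
  define K where "K = (SIGMA i:{..<k}. {..<k} - {i})"
  have K: "finite K" "card K = k * (k - 1)"
    by (auto simp: K_def)
  have "(\<Sum>P\<in>S. card (I P)) \<le> (\<Sum>P\<in>S. card {x \<in> K. fst x \<in> I P \<and> snd x \<in> I P})"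
  proof (rule sum_mono)
    fix P assume P: "P \<in> S"
    have "I P \<subseteq> fst ` {x \<in> K. fst x \<in> I P \<and> snd x \<in> I P}"
    proof
      fix i assume i: "i \<in> I P"
      then obtain j where "j \<in> I P" "j \<noteq> i"
        using two[OF P] by metis
      then have "(i, j) \<in> {x \<in> K. fst x \<in> I P \<and> snd x \<in> I P}"
        using i I[OF P] by (auto simp: K_def)
      then show "i \<in> fst ` {x \<in> K. fst x \<in> I P \<and> snd x \<in> I P}"
        by force
    qed
    then show "card (I P) \<le> card {x \<in> K. fst x \<in> I P \<and> snd x \<in> I P}"
      using K(1) by (intro surj_card_le) auto
  qed
  also have "\<dots> = (\<Sum>x\<in>K. card {P \<in> S. fst x \<in> I P \<and> snd x \<in> I P})"
    using S K(1) by (rule sum_multicount_gen) simp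
  also have "\<dots> \<le> (\<Sum>x\<in>K. N)"
    by (intro sum_mono) (auto simp: K_def intro!: pair)
  finally show ?thesis
    by (simp add: K(2))
qed

theorem theorem2p10:
  fixes d k :: nat and C :: "nat \<Rightarrow> poly3"
  assumes "d \<ge> 1" and "k \<ge> 3"
    and "d_arrangement d k C"
    and "d = 1 \<Longrightarrow> t_num k C (k - 1) = 0"
  shows "conf_seshadri k C \<ge> 1 / (2 * real d * real k + 3 * real d / 2 - 9 / 2)"
proof -
  let ?I = "curves_through k C" and ?S = "Sing k C"
  have smooth: "smooth_curve d (C i)" if "i < k" for i
    using assms(3) that by (simp add: d_arrangement_def)
  then have hom: "homogeneous d (C i)" "\<exists>x. eval3 (C i) x \<noteq> 0" if "i < k" for i
    using that smooth_curve_nonzero_value[of d "C i"]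
    by (auto simp: smooth_curve_def plane_curve_def)
  have ord: "ordinary_singularity (arr_divisor k C) P" if "P \<in> ?S" for P
    using assms(3) that by (simp add: d_arrangement_def)
  have Sing: "?S = {P. \<exists>i\<in>?I P. \<exists>j\<in>?I P. i \<noteq> j}"
    using smooth by (auto simp: Sing_def smooth_curve_def curves_through_def)
  have bezout: "finite (curve_points (C i) \<inter> curve_points (C j)) \<and>
      card (curve_points (C i) \<inter> curve_points (C j)) \<le> d * d"
    if ij: "i < k" "j < k" "i \<noteq> j" for i j
  proof (rule weak_bezout[OF hom[OF ij(1)] hom[OF ij(2)]])
    fix P assume "P \<in> curve_points (C i) \<inter> curve_points (C j)"
    then have "i \<in> ?I P" "j \<in> ?I P"
      using ij by (auto simp: curves_through_def)
    moreover from this have "P \<in> ?S"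
      using ij(3) unfolding Sing by blast
    ultimately show "transversal (C i) (C j) (rep_proj_plane P)"
      using smooth ord ij(3) by (intro ordinary_imp_transversal[of k d C P i j])
  qed
  have "?S \<subseteq> (\<Union>i<k. \<Union>j\<in>{..<k} - {i}. curve_points (C i) \<inter> curve_points (C j))"
    unfolding Sing curves_through_def by blast
  moreover have "finite (\<Union>i<k. \<Union>j\<in>{..<k} - {i}. curve_points (C i) \<inter> curve_points (C j))"
    by (intro finite_UN_I) (auto simp: bezout)
  ultimately have fin: "finite ?S"
    by (rule finite_subset)
  have "(\<Sum>P\<in>?S. card (?I P)) \<le> k * (k - 1) * (d * d)"
  proof (rule sum_multiplicities_le_pairs[OF fin])
    show "card {P \<in> ?S. i \<in> ?I P \<and> j \<in> ?I P} \<le> d * d" if ij: "i < k" "j < k" "i \<noteq> j" for i j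
    proof -
      have "{P \<in> ?S. i \<in> ?I P \<and> j \<in> ?I P} \<subseteq> curve_points (C i) \<inter> curve_points (C j)"
        by (auto simp: curves_through_def)
      then show ?thesis
        using bezout[OF ij] card_mono le_trans by blast
    qed
  qed (auto simp: Sing curves_through_def)
  then have "real (\<Sum>P\<in>?S. card (?I P)) \<le> real (k * (k - 1) * (d * d))"
    by (rule of_nat_mono)
  define B where "B = 2 * real d * real k + 3 * real d / 2 - 9 / 2"
  define M where "M = (\<Sum>P\<in>?S. real (mult_at (arr_divisor k C) P))"
  have M_eq: "M = real (\<Sum>P\<in>?S. card (?I P))"
    by (simp add: M_def mult_at_arr_divisor[OF smooth])
  have "M \<le> real d * real k * (real d * (real k - 1))"
    using \<open>real (\<Sum>P\<in>?S. card (?I P)) \<le> _\<close> assms(2) by (simp add: M_eq of_nat_diff mult_ac)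
  also have "\<dots> \<le> real d * real k * B"
  proof (rule mult_left_mono)
    have "real d * real k \<ge> 1 * 3"
      using assms(1,2) by (intro mult_mono) auto
    then show "real d * (real k - 1) \<le> B"
      using assms(1) by (simp add: B_def algebra_simps)
  qed simp
  finally have upper: "M \<le> real d * real k * B" .
  have "curve_points (C 0) \<inter> curve_points (C 1) \<noteq> {}"
    using assms(1,2) by (intro curves_meet[of d _ d] hom) auto
  then obtain P where "0 \<in> ?I P" "1 \<in> ?I P"
    using assms(2) by (auto simp: curves_through_def)
  then have "P \<in> ?S" "card (?I P) > 0"
    unfolding Sing by (force, auto simp: card_gt_0_iff)
  then have "M > 0"
    using fin unfolding M_eq by (auto intro: sum_pos2)
  have "B > 0"
  proof (rule ccontr)
    assume "\<not> B > 0"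
    then have "real d * real k * B \<le> 0"
      by (intro mult_nonneg_nonpos) auto
    then show False
      using upper \<open>M > 0\<close> by linarith
  qed
  have seshadri: "conf_seshadri k C = real d * real k / M"
    by (simp add: conf_seshadri_def M_def total_deg_arr_divisor[OF smooth])
  then show ?thesis
    using upper \<open>B > 0\<close> \<open>M > 0\<close> unfolding B_def[symmetric] seshadri by (simp add: divide_simps mult_ac)
qed

end
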